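(* Let $E_f:\ y''=f(x,y,y')$ and $E_{\bar f}:\ \bar y''=\bar f(\bar x,\bar y,\bar y')$ be two second order ordinary differential equations. If $E_f$ and $E_{\bar f}$ are strongly equivalent, then their signature indices match.
   Context: **The seven $\mathcal{D}$-groupoids.** Let $\Phi_1,\dots,\Phi_7$ be the $\mathcal{D}$-groupoids of (Taylor series of) locally invertible transformations $(x,y)\mapsto(\bar x,\bar y)$ of $\mathbb{C}^2$ of the following forms, where $C$ is an arbitrary constant and $\xi,\eta$ are arbitrary functions: * $\Phi_1$: $\bar x=x,\ \bar y=\eta(x,y)$; * $\Phi_2$: $\bar x=\xi(x,y),\ \bar y=y$; * $\Phi_3$: $\bar x=x+C,\ \bar y=\eta(x,y)$; * $\Phi_4$: $\bar x=\xi(x,y),\ \bar y=y+C$; * $\Phi_5$: $\bar x=\xi(x),\ \bar y=\eta(x,y)$; * $\Phi_6$: $\bar x=\xi(x,y),\ \bar y=\eta(y)$; * $\Phi_7$: $\bar x=\xi(x,y),\ \bar y=\eta(x,y)$. $\Gamma\Phi_i$ denotes the pseudo-group of local transformations of the corresponding form. **Symmetries.** For a local point transformation $\varphi$, $\varphi_*E_f=E_{\bar f}$ means that $\varphi$ (prolonged to derivatives) maps the equation $E_f$ to $E_{\bar f}$. The symmetry pseudo-group $S_{E_f,\Phi}$ is the pseudo-group of all $\sigma\in\Gamma\Phi$ with $\sigma_*E_f=E_f$. Its dimension $\dim S_{E_f,\Phi}$ is the number of arbitrary constants appearing in the Taylor series solutions (with given source point) of the PDE system $\sigma_*E_f=E_f$,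 $\sigma\in\Gamma\Phi$. **Signature index.** The signature index of $E_f$ is $$\operatorname{sign}(E_f)=\bigl((d_1,d_3,d_5),(d_2,d_4,d_6),d_7\bigr),\qquad d_i=\dim S_{E_f,\Phi_i},\ 1\le i\le 7.$$ Write $s_1=(d_1,d_3,d_5)$ and $s_2=(d_2,d_4,d_6)$, and denote by $\bar d_i,\bar s_1,\bar s_2$ the corresponding quantities for $E_{\bar f}$. The signature indices $\operatorname{sign}(E_f)$ and $\operatorname{sign}(E_{\bar f})$ match if and only if $d_7=\bar d_7$ and ($s_1=\bar s_1$ or $s_2=\bar s_2$). **Strong equivalence.** $E_f$ and $E_{\bar f}$ are strongly equivalent if there exist $\Phi\in\{\Phi_1,\dots,\Phi_7\}$ and $\varphi\in\Gamma\Phi$ such that $\varphi_*E_f=E_{\bar f}$ and $\dim S_{E_{\bar f},\Phi}=0$. *)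

theory Defs
  imports "HOL-Analysis.Analysis" "HOL-Library.Extended_Nat"
begin

section \<open>Holomorphic functions and local transformations\<close>

type_synonym point = "complex \<times> complex"                              (* (x, y) *)
type_synonym jet1 = "complex \<times> complex \<times> complex"                    (* (x, y, y') *)
type_synonym jet2 = "complex \<times> complex \<times> complex \<times> complex"          (* (x, y, y', y'') *)

text \<open>Complex differentiability in several variables: the Frechet derivative exists and is
  complex linear.\<close>

definition holomorphic2_on :: "(point \<Rightarrow> complex) \<Rightarrow> point set \<Rightarrow> bool" where
  "holomorphic2_on g U \<longleftrightarrow>
     (\<forall>z\<in>U. \<exists>a b. (g has_derivative (\<lambda>(h, k). a * h + b * k)) (at z))"

definition holomorphic3_on :: "(jet1 \<Rightarrow> complex) \<Rightarrow> jet1 set \<Rightarrow> bool" where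
  "holomorphic3_on g D \<longleftrightarrow>
     (\<forall>z\<in>D. \<exists>a b c. (g has_derivative (\<lambda>(h, k, l). a * h + b * k + c * l)) (at z))"

definition holomorphic_map_on :: "(point \<Rightarrow> point) \<Rightarrow> point set \<Rightarrow> bool" where
  "holomorphic_map_on \<phi> U \<longleftrightarrow>
     holomorphic2_on (\<lambda>z. fst (\<phi> z)) U \<and> holomorphic2_on (\<lambda>z. snd (\<phi> z)) U"

definition local_transformation :: "point set \<Rightarrow> (point \<Rightarrow> point) \<Rightarrow> bool" where
  "local_transformation U \<phi> \<longleftrightarrow>
     open U \<and> open (\<phi> ` U) \<and> holomorphic_map_on \<phi> U \<and>
     (\<exists>\<psi>. holomorphic_map_on \<psi> (\<phi> ` U) \<and> (\<forall>z\<in>U. \<psi> (\<phi> z) = z))"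


section \<open>The seven pseudo-groups\<close>

datatype groupoid = Phi1 | Phi2 | Phi3 | Phi4 | Phi5 | Phi6 | Phi7

primrec has_form :: "groupoid \<Rightarrow> point set \<Rightarrow> (point \<Rightarrow> point) \<Rightarrow> bool" where
  "has_form Phi1 U \<phi> \<longleftrightarrow> (\<forall>(x, y)\<in>U. fst (\<phi> (x, y)) = x)"
| "has_form Phi2 U \<phi> \<longleftrightarrow> (\<forall>(x, y)\<in>U. snd (\<phi> (x, y)) = y)"
| "has_form Phi3 U \<phi> \<longleftrightarrow> (\<exists>C. \<forall>(x, y)\<in>U. fst (\<phi> (x, y)) = x + C)"
| "has_form Phi4 U \<phi> \<longleftrightarrow> (\<exists>C. \<forall>(x, y)\<in>U. snd (\<phi> (x, y)) = y + C)"
| "has_form Phi5 U \<phi> \<longleftrightarrow> (\<exists>\<xi>. \<forall>(x, y)\<in>U. fst (\<phi> (x, y)) = \<xi> x)"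
| "has_form Phi6 U \<phi> \<longleftrightarrow> (\<exists>\<eta>. \<forall>(x, y)\<in>U. snd (\<phi> (x, y)) = \<eta> y)"
| "has_form Phi7 U \<phi> \<longleftrightarrow> True"

definition pseudogroup :: "groupoid \<Rightarrow> (point set \<times> (point \<Rightarrow> point)) set" where
  "pseudogroup \<Phi> = {(U, \<phi>). local_transformation U \<phi> \<and> has_form \<Phi> U \<phi>}"


section \<open>Prolongation of point transformations\<close>

text \<open>Total derivative of a function of \<open>(x, y)\<close>, respectively of \<open>(x, y, y')\<close>, along a curve
  with the given derivatives.\<close>

definition total_deriv1 :: "(point \<Rightarrow> complex) \<Rightarrow> jet1 \<Rightarrow> complex" where
  "total_deriv1 g = (\<lambda>(x, y, p). deriv (\<lambda>t. g (t, y)) x + p * deriv (\<lambda>t. g (x, t)) y)"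

definition total_deriv2 :: "(jet1 \<Rightarrow> complex) \<Rightarrow> jet2 \<Rightarrow> complex" where
  "total_deriv2 g = (\<lambda>(x, y, p, q).
     deriv (\<lambda>t. g (t, y, p)) x + p * deriv (\<lambda>t. g (x, t, p)) y + q * deriv (\<lambda>t. g (x, y, t)) p)"

definition prolonged_slope :: "(point \<Rightarrow> point) \<Rightarrow> jet1 \<Rightarrow> complex" where
  "prolonged_slope \<phi> z =
     total_deriv1 (\<lambda>w. snd (\<phi> w)) z / total_deriv1 (\<lambda>w. fst (\<phi> w)) z"

definition prolong1 :: "(point \<Rightarrow> point) \<Rightarrow> jet1 \<Rightarrow> jet1" where
  "prolong1 \<phi> = (\<lambda>(x, y, p).
     (fst (\<phi> (x, y)), snd (\<phi> (x, y)), prolonged_slope \<phi> (x, y, p)))"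

definition prolong2 :: "(point \<Rightarrow> point) \<Rightarrow> jet2 \<Rightarrow> jet2" where
  "prolong2 \<phi> = (\<lambda>(x, y, p, q).
     (fst (\<phi> (x, y)), snd (\<phi> (x, y)), prolonged_slope \<phi> (x, y, p),
      total_deriv2 (prolonged_slope \<phi>) (x, y, p, q) / total_deriv1 (\<lambda>w. fst (\<phi> w)) (x, y, p)))"


section \<open>Second order equations and their symmetries\<close>

definition second_order_ode :: "jet1 set \<Rightarrow> (jet1 \<Rightarrow> complex) \<Rightarrow> bool" where
  "second_order_ode D f \<longleftrightarrow> open D \<and> holomorphic3_on f D"

definition equation :: "jet1 set \<Rightarrow> (jet1 \<Rightarrow> complex) \<Rightarrow> jet2 set" where
  "equation D f = {(x, y, p, q). (x, y, p) \<in> D \<and> q = f (x, y, p)}"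

definition source :: "jet1 \<Rightarrow> point" where
  "source = (\<lambda>(x, y, p). (x, y))"

text \<open>\<open>\<phi>\<close> maps the equation \<open>E\<close> to \<open>E'\<close> near the 1-jet \<open>z\<close>. As the prolongation is only
  defined where the total derivative of the first component does not vanish (elsewhere the image
  curve is vertical), and as \<open>f\<close> may be defined on any open set of 1-jets, the relation is
  local in the 1-jets and not only in \<open>(x, y)\<close>. This is what makes it compatible
  with composition.\<close>

definition maps_equation :: "(point \<Rightarrow> point) \<Rightarrow> jet1 \<Rightarrow> jet2 set \<Rightarrow> jet2 set \<Rightarrow> bool" where
  "maps_equation \<phi> z E E' \<longleftrightarrow>
     (\<exists>N. open N \<and> z \<in> N \<and>
        (\<forall>(x, y, p)\<in>N. total_deriv1 (\<lambda>w. fst (\<phi> w)) (x, y, p) \<noteq> 0 \<and>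
           (\<forall>q. (x, y, p, q) \<in> E \<longleftrightarrow> prolong2 \<phi> (x, y, p, q) \<in> E')))"

text \<open>The symmetries of \<open>E\<close> in a pseudo-group, as transformations near the source point of \<open>z\<close>.
  Their target point is arbitrary.\<close>

definition symmetries :: "jet2 set \<Rightarrow> groupoid \<Rightarrow> jet1 \<Rightarrow> (point set \<times> (point \<Rightarrow> point)) set" where
  "symmetries E \<Phi> z =
     {(U, \<sigma>) \<in> pseudogroup \<Phi>. source z \<in> U \<and> maps_equation \<sigma> z E E}"


section \<open>Dimension of the symmetry pseudo-group\<close>

text \<open>The derivatives of both components at a point, i.e. the Taylor series up to the factorials.\<close>

definition taylor :: "(point \<Rightarrow> point) \<Rightarrow> point \<Rightarrow> nat \<Rightarrow> nat \<Rightarrow> point" where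
  "taylor \<sigma> = (\<lambda>(x\<^sub>0, y\<^sub>0) i j.
     ((deriv ^^ i) (\<lambda>x. (deriv ^^ j) (\<lambda>y. fst (\<sigma> (x, y))) y\<^sub>0) x\<^sub>0,
      (deriv ^^ i) (\<lambda>x. (deriv ^^ j) (\<lambda>y. snd (\<sigma> (x, y))) y\<^sub>0) x\<^sub>0))"

text \<open>The space of \<open>d\<close> complex parameters; \<open>d\<close> has to vary inside the definition of the dimension.\<close>

definition param_space :: "nat \<Rightarrow> (nat \<Rightarrow> complex) set" where
  "param_space d = {c. \<forall>i\<ge>d. c i = 0}"

text \<open>The Taylor series solutions contain (at least) \<open>d\<close> arbitrary constants: there is a
  family of symmetries, holomorphic in \<open>d\<close> parameters ranging over an open set, whose
  members have pairwise different Taylor series at the source point. (A jointly continuous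
  function that is holomorphic in each variable separately is holomorphic by Osgood's lemma. A
  common domain \<open>V\<close> for all members is not a restriction, because the set of parameters may
  be shrunk.)\<close>

definition has_arbitrary_constants :: "jet2 set \<Rightarrow> groupoid \<Rightarrow> jet1 \<Rightarrow> nat \<Rightarrow> bool" where
  "has_arbitrary_constants E \<Phi> z d \<longleftrightarrow>
     (\<exists>W V (\<sigma> :: (nat \<Rightarrow> complex) \<Rightarrow> point \<Rightarrow> point).
        W \<noteq> {} \<and> openin (top_of_set (param_space d)) W \<and>
        (\<forall>c\<in>W. (V, \<sigma> c) \<in> symmetries E \<Phi> z) \<and>
        continuous_on (W \<times> V) (\<lambda>(c, w). \<sigma> c w) \<and>
        (\<forall>c\<in>W. \<forall>w\<in>V. \<forall>i<d.
           (\<lambda>t. fst (\<sigma> (c(i := t)) w)) field_differentiable (at (c i)) \<and>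
           (\<lambda>t. snd (\<sigma> (c(i := t)) w)) field_differentiable (at (c i))) \<and>
        inj_on (\<lambda>c. taylor (\<sigma> c) (source z)) W)"

definition sym_dim :: "jet2 set \<Rightarrow> groupoid \<Rightarrow> jet1 \<Rightarrow> enat" where
  "sym_dim E \<Phi> z = Sup {enat d |d. has_arbitrary_constants E \<Phi> z d}"


section \<open>Signature index and strong equivalence\<close>

type_synonym signature_index = "(enat \<times> enat \<times> enat) \<times> (enat \<times> enat \<times> enat) \<times> enat"

definition signature_index :: "jet2 set \<Rightarrow> jet1 \<Rightarrow> signature_index" where
  "signature_index E z =
     ((sym_dim E Phi1 z, sym_dim E Phi3 z, sym_dim E Phi5 z),
      (sym_dim E Phi2 z, sym_dim E Phi4 z, sym_dim E Phi6 z),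
      sym_dim E Phi7 z)"

definition signatures_match :: "signature_index \<Rightarrow> signature_index \<Rightarrow> bool" where
  "signatures_match S S' \<longleftrightarrow>
     (case (S, S') of ((s1, s2, d7), (s1', s2', d7')) \<Rightarrow>
        d7 = d7' \<and> (s1 = s1' \<or> s2 = s2'))"

definition strongly_equivalent :: "jet2 set \<Rightarrow> jet1 \<Rightarrow> jet2 set \<Rightarrow> jet1 \<Rightarrow> bool" where
  "strongly_equivalent E z E' z' \<longleftrightarrow>
     (\<exists>\<Phi> U \<phi>. (U, \<phi>) \<in> pseudogroup \<Phi> \<and> source z \<in> U \<and> prolong1 \<phi> z = z' \<and>
        maps_equation \<phi> z E E' \<and> sym_dim E' \<Phi> z' = 0)"

end

theory Submission
  imports Defs "HOL-Complex_Analysis.Complex_Analysis"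
begin

text \<open>If \<open>\<phi>\<close> belongs to \<open>\<Gamma>\<Phi>\<close> and maps \<open>E\<close> to \<open>E'\<close>, conjugation by \<open>\<phi>\<close> turns the \<open>\<Phi>\<close>-symmetries of \<open>E\<close> into
  those of \<open>E'\<close>, so the two dimensions agree. The groupoids containing \<open>\<Phi>\<close> contain \<open>\<phi>\<close> too, hence their
  dimensions agree as well; for the groupoids contained in \<open>\<Phi>\<close> both dimensions are bounded by
  \<open>dim S\<^bsub>E',\<Phi>\<^esub> = 0\<close>. Every \<open>\<Phi>\<close> is comparable with all members of one of the two chains
  \<open>\<Phi>\<^sub>1 \<subset> \<Phi>\<^sub>3 \<subset> \<Phi>\<^sub>5 \<subset> \<Phi>\<^sub>7\<close> and \<open>\<Phi>\<^sub>2 \<subset> \<Phi>\<^sub>4 \<subset> \<Phi>\<^sub>6 \<subset> \<Phi>\<^sub>7\<close>.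

  A symmetry may move the base point out of the domain of \<open>\<phi>\<close>, so \<open>\<phi> \<circ> \<sigma>\<^sub>c \<circ> \<phi>\<^sup>-\<^sup>1\<close> need not be
  defined. A family \<open>\<sigma>\<^sub>c\<close> is therefore conjugated to \<open>\<phi> \<circ> \<sigma>\<^sub>c\<^sub>0\<^sup>-\<^sup>1 \<circ> \<sigma>\<^sub>c \<circ> \<phi>\<^sup>-\<^sup>1\<close> with \<open>c\<close> near a fixed
  parameter \<open>c\<^sub>0\<close>. That this maps \<open>E'\<close> to itself uses that the 1-jet of \<open>\<sigma>\<^sub>c\<close> depends continuously
  on \<open>c\<close>, which follows from Cauchy's integral formula.\<close>

section \<open>Holomorphic functions of two variables\<close>

definition partial1 :: "(point \<Rightarrow> complex) \<Rightarrow> point \<Rightarrow> complex" where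
  "partial1 g = (\<lambda>(x, y). deriv (\<lambda>t. g (t, y)) x)"

definition partial2 :: "(point \<Rightarrow> complex) \<Rightarrow> point \<Rightarrow> complex" where
  "partial2 g = (\<lambda>(x, y). deriv (\<lambda>t. g (x, t)) y)"

text \<open>Cauchy's formula for the first derivative. The circle is parametrised over the fixed
  interval [0, 1], so that theorems on integrals depending on a parameter apply.\<close>

lemma deriv_eq_circle_integral:
  assumes "0 < r" and "f holomorphic_on cball x r"
  shows "deriv f x = integral (cbox 0 1)
    (\<lambda>t. f (x + of_real r * exp (2 * of_real pi * \<i> * of_real t)) /
         (of_real r * exp (2 * of_real pi * \<i> * of_real t)))"
proof -
  let ?e = "\<lambda>t. exp (2 * of_real pi * \<i> * of_real t) :: complex"
  have "((\<lambda>u. f u / (u - x) ^ Suc 1) has_contour_integral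
      (2 * pi * \<i>) / fact 1 * (deriv ^^ 1) f x) (circlepath x r)"
    using assms by (intro Cauchy_has_contour_integral_higher_derivative_circlepath)
      (auto intro: holomorphic_on_imp_continuous_on holomorphic_on_subset)
  then have "((\<lambda>t. f (x + r * ?e t) / (r * ?e t) ^ 2 * (2 * pi * \<i> * r * ?e t)) has_integral
      (2 * pi * \<i>) * deriv f x) (cbox 0 1)"
    unfolding has_contour_integral vector_derivative_circlepath
    by (simp add: circlepath power2_eq_square)
  \<comment> \<open>After division by 2 pi i, the velocity of the circle cancels all but one factor
    \<open>r * ?e t\<close> of the squared denominator.\<close>
  then have "((\<lambda>t. inverse (2 * pi * \<i>) * (f (x + r * ?e t) / (r * ?e t) ^ 2 * (2 * pi * \<i> * r * ?e t))) has_integral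
      inverse (2 * pi * \<i>) * ((2 * pi * \<i>) * deriv f x)) (cbox 0 1)"
    by (rule has_integral_mult_right)
  then have "((\<lambda>t. f (x + r * ?e t) / (r * ?e t)) has_integral deriv f x) (cbox 0 1)"
    using \<open>0 < r\<close> by (simp add: power2_eq_square field_simps)
  then show ?thesis
    by (simp add: integral_unique)
qed

lemma circle_point_in_ball:
  assumes "0 < r" and "x \<in> ball x0 r"
  shows "x + of_real r * exp (2 * of_real pi * \<i> * of_real t) \<in> ball x0 (2 * r)"
proof -
  have "norm (of_real r * exp (2 * of_real pi * \<i> * of_real t)) = r"
    using assms by (simp add: norm_mult)
  moreover have "norm (x - x0) < r"
    using assms by (simp add: dist_norm norm_minus_commute)
  ultimately have "norm (x - x0 + of_real r * exp (2 * of_real pi * \<i> * of_real t)) < 2 * r"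
    using norm_triangle_ineq by (smt (verit))
  then show ?thesis
    by (simp add: dist_norm norm_minus_commute algebra_simps)
qed

lemma cball_subset_double_ball: "x \<in> ball x0 r \<Longrightarrow> cball x r \<subseteq> ball x0 (2 * r)"
  for x x0 :: complex
proof
  fix u assume "x \<in> ball x0 r" "u \<in> cball x r"
  then show "u \<in> ball x0 (2 * r)"
    using dist_triangle[of x0 u x] by simp
qed

text \<open>Cauchy's formula writes the derivative as an integral over a compact interval whose
  integrand is jointly continuous in \<open>(c, x)\<close> and \<open>t\<close>. Continuity is asked
  on the ball of radius \<open>2 * r\<close> because circles of radius \<open>r\<close> about points
  of \<open>ball x0 r\<close> stay inside it.\<close>

lemma continuous_on_deriv_param:
  fixes F :: "'a::topological_space \<Rightarrow> complex \<Rightarrow> complex"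
  assumes r: "0 < r"
    and cont: "continuous_on (W \<times> ball x0 (2 * r)) (\<lambda>(c, x). F c x)"
    and hol: "\<And>c. c \<in> W \<Longrightarrow> F c holomorphic_on ball x0 (2 * r)"
  shows "continuous_on (W \<times> ball x0 r) (\<lambda>(c, x). deriv (F c) x)"
proof -
  let ?e = "\<lambda>t. exp (2 * of_real pi * \<i> * of_real t) :: complex"
  have "continuous_on ((W \<times> ball x0 r) \<times> cbox 0 1)
      (\<lambda>((c, x), t). F c (x + r * ?e t) / (r * ?e t))"
    unfolding split_beta
    using r by (intro continuous_intros continuous_on_compose2[OF cont[unfolded split_beta],
          where f = "\<lambda>q. (fst (fst q), snd (fst q) + r * ?e (snd q))", simplified])
      (auto intro!: circle_point_in_ball simp del: mem_ball)
  then have *: "continuous_on (W \<times> ball x0 r)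
      (\<lambda>q. integral (cbox 0 1) (\<lambda>t. F (fst q) (snd q + r * ?e t) / (r * ?e t)))"
    by (intro integral_continuous_on_param) (simp add: split_beta)
  have "deriv (F c) x = integral (cbox 0 1) (\<lambda>t. F c (x + r * ?e t) / (r * ?e t))"
    if "c \<in> W" "x \<in> ball x0 r" for c x
    using that r by (intro deriv_eq_circle_integral holomorphic_on_subset[OF hol]
        cball_subset_double_ball) auto
  then show ?thesis
    by (intro continuous_on_eq[OF *]) auto
qed

lemma open_contains_ball_Times:
  assumes "open V" and "(x, y) \<in> V"
  obtains r where "0 < r" and "ball (x::complex) r \<times> ball (y::complex) r \<subseteq> V"
proof -
  obtain A B where AB: "open A" "open B" "x \<in> A" "y \<in> B" "A \<times> B \<subseteq> V"
    using assms open_prod_elim[of V "(x, y)"] by (metis mem_Sigma_iff)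
  obtain r s where "0 < r" "ball x r \<subseteq> A" "0 < s" "ball y s \<subseteq> B"
    using AB open_contains_ball by metis
  then have "ball x (min r s) \<times> ball y (min r s) \<subseteq> A \<times> B"
    by (intro Sigma_mono) auto
  with AB(5) \<open>0 < r\<close> \<open>0 < s\<close> show ?thesis
    by (intro that[of "min r s"]) auto
qed

text \<open>Continuity is local, so a box inside \<open>V\<close> is enough. There the variable
  \<open>y\<close> joins the parameter, and \<open>continuous_on_deriv_param\<close> applies with
  parameter \<open>(c, y)\<close>.\<close>

lemma continuous_on_partial1_param:
  fixes g :: "'a::topological_space \<Rightarrow> point \<Rightarrow> complex"
  assumes V: "open V"
    and cont: "continuous_on (W \<times> V) (\<lambda>(c, w). g c w)"
    and hol: "\<And>c x y. c \<in> W \<Longrightarrow> (x, y) \<in> V \<Longrightarrow> (\<lambda>t. g c (t, y)) field_differentiable at x"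
  shows "continuous_on (W \<times> V) (\<lambda>(c, w). partial1 (g c) w)"
  unfolding continuous_on_def
proof
  fix q assume "q \<in> W \<times> V"
  then obtain c0 x0 y0 where q: "q = (c0, x0, y0)" and c0: "c0 \<in> W" and w0: "(x0, y0) \<in> V"
    by auto
  obtain r where r: "0 < r" "ball x0 r \<times> ball y0 r \<subseteq> V"
    using open_contains_ball_Times[OF V w0] .
  define s where "s = r / 2"
  have s: "0 < s" "2 * s = r" "s \<le> r"
    using r by (auto simp: s_def)
  have sub: "ball x0 s \<times> ball y0 s \<subseteq> V"
    using r s by (auto intro!: subsetD[OF r(2)])
  have *: "continuous_on ((W \<times> ball y0 s) \<times> ball x0 s)
      (\<lambda>(q, x). deriv ((\<lambda>(c, y) t. g c (t, y)) q) x)"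
  proof (rule continuous_on_deriv_param)
    show "continuous_on ((W \<times> ball y0 s) \<times> ball x0 (2 * s)) (\<lambda>(q, x). (\<lambda>(c, y) t. g c (t, y)) q x)"
      unfolding split_beta using r s
      by (intro continuous_on_compose2[OF cont[unfolded split_beta],
          where f = "\<lambda>q. (fst (fst q), (snd q, snd (fst q)))", simplified]
          continuous_intros) auto
    show "(\<lambda>(c, y) t. g c (t, y)) q holomorphic_on ball x0 (2 * s)" if qW: "q \<in> W \<times> ball y0 s" for q
    proof -
      obtain c y where q: "q = (c, y)" "c \<in> W" "y \<in> ball y0 s"
        using qW by (elim SigmaE)
      have "(\<lambda>t. g c (t, y)) field_differentiable at x within ball x0 (2 * s)" if "x \<in> ball x0 (2 * s)" for x
      proof -
        have "(x, y) \<in> V"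
          using that q r s by auto
        then show ?thesis
          using q by (auto intro: field_differentiable_at_within hol)
      qed
      then show ?thesis
        by (simp add: q holomorphic_on_def)
    qed
  qed (use s in auto)
  have "continuous_on (W \<times> (ball x0 s \<times> ball y0 s)) (\<lambda>(c, w). partial1 (g c) w)"
    unfolding split_beta partial1_def
    by (rule continuous_on_compose2[OF *[unfolded split_beta], where f = "\<lambda>q. ((fst q, snd (snd q)), fst (snd q))", simplified])
      (auto intro!: continuous_intros)
  from this[unfolded continuous_on_def, THEN bspec, of "(c0, x0, y0)"]
  have "((\<lambda>(c, w). partial1 (g c) w) \<longlongrightarrow> (case (c0, x0, y0) of (c, w) \<Rightarrow> partial1 (g c) w))
      (at (c0, x0, y0) within W \<times> (ball x0 s \<times> ball y0 s))"
    using c0 s by simp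
  \<comment> \<open>The box is open, so restricting to it does not change the relative
    neighbourhoods of the point.\<close>
  moreover have "at (c0, x0, y0) within W \<times> (ball x0 s \<times> ball y0 s) = at (c0, x0, y0) within W \<times> V"
    by (intro at_within_nhd[where S = "UNIV \<times> (ball x0 s \<times> ball y0 s)"])
      (use s sub in \<open>auto intro!: open_Times\<close>)
  ultimately show "((\<lambda>(c, w). partial1 (g c) w) \<longlongrightarrow> (case q of (c, w) \<Rightarrow> partial1 (g c) w))
      (at q within W \<times> V)"
    by (simp add: q)
qed

text \<open>Lets results on \<open>partial1\<close> be carried over to \<open>partial2\<close> by
  exchanging the coordinates.\<close>

lemma partial2_eq_partial1_swap: "partial2 g w = partial1 (\<lambda>w. g (prod.swap w)) (prod.swap w)"
  by (simp add: partial1_def partial2_def split_beta)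

lemma open_swap_vimage: "open V \<Longrightarrow> open (prod.swap -` V :: ('a::topological_space \<times> 'b::topological_space) set)"
  by (rule open_vimage) (auto intro!: continuous_intros simp: prod.swap_def)

lemma continuous_on_partial2_param:
  fixes g :: "'a::topological_space \<Rightarrow> point \<Rightarrow> complex"
  assumes V: "open V"
    and cont: "continuous_on (W \<times> V) (\<lambda>(c, w). g c w)"
    and hol: "\<And>c x y. c \<in> W \<Longrightarrow> (x, y) \<in> V \<Longrightarrow> (\<lambda>t. g c (x, t)) field_differentiable at y"
  shows "continuous_on (W \<times> V) (\<lambda>(c, w). partial2 (g c) w)"
proof -
  have *: "continuous_on (W \<times> prod.swap -` V) (\<lambda>(c, w). partial1 (\<lambda>w. g c (prod.swap w)) w)"
  proof (rule continuous_on_partial1_param)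
    show "continuous_on (W \<times> prod.swap -` V) (\<lambda>(c, w). g c (prod.swap w))"
      unfolding split_beta
      by (rule continuous_on_compose2[OF cont[unfolded split_beta],
          where f = "\<lambda>q. (fst q, prod.swap (snd q))", simplified])
        (auto intro!: continuous_intros simp: prod.swap_def)
  qed (use V hol in \<open>auto intro: open_swap_vimage\<close>)
  show ?thesis
    unfolding split_beta partial2_eq_partial1_swap
    by (rule continuous_on_compose2[OF *[unfolded split_beta],
          where f = "\<lambda>q. (fst q, prod.swap (snd q))", simplified])
      (auto intro!: continuous_intros simp: prod.swap_def)
qed

lemma continuous_on_partial:
  assumes V: "open V" and cont: "continuous_on V g"
  shows "(\<And>x y. (x, y) \<in> V \<Longrightarrow> (\<lambda>t. g (t, y)) field_differentiable at x) \<Longrightarrow> continuous_on V (partial1 g)"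
    and "(\<And>x y. (x, y) \<in> V \<Longrightarrow> (\<lambda>t. g (x, t)) field_differentiable at y) \<Longrightarrow> continuous_on V (partial2 g)"
proof -
  \<comment> \<open>The case without parameter is the case of a one-point parameter space.\<close>
  have *: "continuous_on ({0::complex} \<times> V) (\<lambda>(c, w). g w)"
    unfolding split_beta by (rule continuous_on_compose2[OF cont]) (auto intro!: continuous_intros)
  have **: "continuous_on V h" if "continuous_on ({0::complex} \<times> V) (\<lambda>(c, w). h w)" for h :: "point \<Rightarrow> complex"
    by (rule continuous_on_compose2[OF that, where f = "\<lambda>w. (0, w)", simplified])
      (auto intro!: continuous_intros)
  show "continuous_on V (partial1 g)"
    if "\<And>x y. (x, y) \<in> V \<Longrightarrow> (\<lambda>t. g (t, y)) field_differentiable at x"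
    by (rule **, rule continuous_on_partial1_param[OF V *]) (use that in auto)
  show "continuous_on V (partial2 g)"
    if "\<And>x y. (x, y) \<in> V \<Longrightarrow> (\<lambda>t. g (x, t)) field_differentiable at y"
    by (rule **, rule continuous_on_partial2_param[OF V *]) (use that in auto)
qed

section \<open>Separate holomorphy and Osgood's lemma\<close>

definition sep_holomorphic_on :: "(point \<Rightarrow> complex) \<Rightarrow> point set \<Rightarrow> bool" where
  "sep_holomorphic_on g U \<longleftrightarrow> continuous_on U g \<and>
     (\<forall>(x, y)\<in>U. (\<lambda>t. g (t, y)) field_differentiable at x \<and> (\<lambda>t. g (x, t)) field_differentiable at y)"

lemma has_derivative_partials:
  assumes "(g has_derivative (\<lambda>(h, k). a * h + b * k)) (at (x, y))"
  shows "((\<lambda>t. g (t, y)) has_field_derivative a) (at x)"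
    and "((\<lambda>t. g (x, t)) has_field_derivative b) (at y)"
    and "partial1 g (x, y) = a" and "partial2 g (x, y) = b"
proof -
  have "((\<lambda>t. g (t, y)) has_derivative (\<lambda>h. (\<lambda>(h, k). a * h + b * k) (h, 0))) (at x)"
    by (rule has_derivative_compose[where f = "\<lambda>t. (t, y)" and g = g])
      (use assms in \<open>auto intro!: derivative_eq_intros\<close>)
  then show 1: "((\<lambda>t. g (t, y)) has_field_derivative a) (at x)"
    by (simp add: has_field_derivative_def)
  have "((\<lambda>t. g (x, t)) has_derivative (\<lambda>k. (\<lambda>(h, k). a * h + b * k) (0, k))) (at y)"
    by (rule has_derivative_compose[where f = "\<lambda>t. (x, t)" and g = g])
      (use assms in \<open>auto intro!: derivative_eq_intros\<close>)
  then show 2: "((\<lambda>t. g (x, t)) has_field_derivative b) (at y)"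
    by (simp add: has_field_derivative_def)
  show "partial1 g (x, y) = a" "partial2 g (x, y) = b"
    using 1 2 by (auto simp: partial1_def partial2_def intro: DERIV_imp_deriv)
qed

lemma holomorphic2_has_derivative:
  assumes "holomorphic2_on g U" and "w \<in> U"
  shows "(g has_derivative (\<lambda>(h, k). partial1 g w * h + partial2 g w * k)) (at w)"
proof -
  obtain a b where ab: "(g has_derivative (\<lambda>(h, k). a * h + b * k)) (at w)"
    using assms unfolding holomorphic2_on_def by blast
  then show ?thesis
    using has_derivative_partials(3,4)[of g a b "fst w" "snd w"] by simp
qed

lemma holomorphic2_imp_continuous_on: "holomorphic2_on g U \<Longrightarrow> continuous_on U g"
  by (meson continuous_at_imp_continuous_on has_derivative_continuous holomorphic2_has_derivative)

lemma holomorphic2_imp_sep: "holomorphic2_on g U \<Longrightarrow> sep_holomorphic_on g U"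
  unfolding sep_holomorphic_on_def
  using holomorphic2_imp_continuous_on holomorphic2_has_derivative
  by (fastforce simp: field_differentiable_def dest: has_derivative_partials)

text \<open>Osgood's lemma. Joint differentiability follows from the existence of both partial
  derivatives and the continuity of one of them; that continuity comes from Cauchy's formula through
  \<open>continuous_on_partial\<close>.\<close>

lemma sep_imp_holomorphic2:
  assumes U: "open U" and g: "sep_holomorphic_on g U"
  shows "holomorphic2_on g U"
  unfolding holomorphic2_on_def
proof
  fix w assume "w \<in> U"
  obtain x y where w: "w = (x, y)" by (cases w)
  with \<open>w \<in> U\<close> obtain r where r: "0 < r" "ball x r \<times> ball y r \<subseteq> U"
    using open_contains_ball_Times[OF U] by metis
  have c2: "continuous_on U (partial2 g)"
    by (rule continuous_on_partial(2)[OF U]) (use g in \<open>auto simp: sep_holomorphic_on_def\<close>)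
  have "((\<lambda>(x, y). g (x, y)) has_derivative
      (\<lambda>(h, k). (*) (partial1 g (x, y)) h + blinfun_mult_right (partial2 g (x, y)) k)) (at (x, y) within ball x r \<times> ball y r)"
  proof (rule has_derivative_partialsI)
    show "((\<lambda>t. g (t, y)) has_derivative (*) (partial1 g (x, y))) (at x within ball x r)"
    proof -
      have "((\<lambda>t. g (t, y)) has_field_derivative partial1 g (x, y)) (at x)"
        using g \<open>w \<in> U\<close> unfolding w sep_holomorphic_on_def partial1_def
        by (auto simp: DERIV_deriv_iff_field_differentiable)
      then show ?thesis
        by (simp add: has_field_derivative_def has_derivative_at_withinI)
    qed
    show "((\<lambda>t. g (a, t)) has_derivative blinfun_apply (blinfun_mult_right (partial2 g (a, b)))) (at b within ball y r)"
      if "a \<in> ball x r" "b \<in> ball y r" for a b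
    proof -
      have "(a, b) \<in> U"
        using that r by blast
      then have "((\<lambda>t. g (a, t)) has_field_derivative partial2 g (a, b)) (at b)"
        using g unfolding sep_holomorphic_on_def partial2_def
        by (auto simp: DERIV_deriv_iff_field_differentiable)
      then show ?thesis
        by (simp add: has_field_derivative_def has_derivative_at_withinI)
    qed
    have "continuous_on (ball x r \<times> ball y r) (\<lambda>w. blinfun_mult_right (partial2 g w))"
      by (intro bounded_linear.continuous_on[OF bounded_linear_blinfun_mult_right]
          continuous_on_subset[OF c2] r)
    then show "continuous (at (x, y) within ball x r \<times> ball y r) (\<lambda>(x, y). blinfun_mult_right (partial2 g (x, y)))"
      using r by (simp add: continuous_on_eq_continuous_within case_prod_beta')
  qed (use r in auto)
  moreover have "at (x, y) within ball x r \<times> ball y r = at (x, y)"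
    using r by (intro at_within_open) (auto intro: open_Times)
  ultimately show "\<exists>a b. (g has_derivative (\<lambda>(h, k). a * h + b * k)) (at w)"
    by (auto simp: w)
qed

text \<open>In \<open>x\<close> this is the holomorphy of the derivative of a holomorphic function.
  In \<open>y\<close> the derivative is written as a Cauchy integral over a circle in the
  \<open>x\<close>-plane and differentiated under the integral sign.\<close>

lemma sep_holomorphic_partial1:
  assumes U: "open U" and g: "sep_holomorphic_on g U"
  shows "sep_holomorphic_on (partial1 g) U"
proof -
  have cont: "continuous_on U g"
    and dx: "\<And>x y. (x, y) \<in> U \<Longrightarrow> (\<lambda>t. g (t, y)) field_differentiable at x"
    and dy: "\<And>x y. (x, y) \<in> U \<Longrightarrow> (\<lambda>t. g (x, t)) field_differentiable at y"
    using g by (auto simp: sep_holomorphic_on_def)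
  have c1: "continuous_on U (partial1 g)" and c2: "continuous_on U (partial2 g)"
    using continuous_on_partial[OF U cont] dx dy by blast+
  have "(\<lambda>t. partial1 g (t, y)) field_differentiable at x \<and>
      (\<lambda>t. partial1 g (x, t)) field_differentiable at y" if xy: "(x, y) \<in> U" for x y
  proof
    obtain r where r: "0 < r" "ball x r \<times> ball y r \<subseteq> U"
      using open_contains_ball_Times[OF U xy] .
    have in_U: "(a, b) \<in> U" if "a \<in> ball x r" "b \<in> ball y r" for a b
      using that r by blast
    have hol: "(\<lambda>t. g (t, b)) holomorphic_on ball x r" if "b \<in> ball y r" for b
      unfolding holomorphic_on_def using that by (auto intro!: field_differentiable_at_within dx in_U)
    have "deriv (\<lambda>t. g (t, y)) holomorphic_on ball x r"
      using r by (intro holomorphic_deriv hol) auto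
    then show "(\<lambda>t. partial1 g (t, y)) field_differentiable at x"
      using r by (simp add: partial1_def holomorphic_on_imp_differentiable_at)
    \<comment> \<open>Half the radius keeps the circle about \<open>x\<close> and the disc it bounds
      inside \<open>ball x r\<close>.\<close>
    define s where "s = r / 2"
    have s: "0 < s" "2 * s = r" using r by (auto simp: s_def)
    let ?e = "\<lambda>t. exp (2 * of_real pi * \<i> * of_real t) :: complex"
    have e: "x + of_real s * ?e t \<in> ball x r" for t
      using circle_point_in_ball[of s x x t] s by simp
    have "(\<lambda>b. integral (cbox 0 1) (\<lambda>t. g (x + s * ?e t, b) / (s * ?e t))) holomorphic_on ball y r"
    proof (rule leibniz_rule_holomorphic)
      show "((\<lambda>b. g (x + s * ?e t, b) / (s * ?e t)) has_field_derivative
          partial2 g (x + s * ?e t, b) / (s * ?e t)) (at b within ball y r)" if "b \<in> ball y r" for b t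
      proof -
        have "((\<lambda>b. g (x + s * ?e t, b)) has_field_derivative partial2 g (x + s * ?e t, b)) (at b)"
          using dy[OF in_U[OF e that]] by (simp add: partial2_def DERIV_deriv_iff_field_differentiable)
        then show ?thesis
          by (rule DERIV_cdivide[OF has_field_derivative_at_within])
      qed
      show "(\<lambda>t. g (x + s * ?e t, b) / (s * ?e t)) integrable_on cbox 0 1" if "b \<in> ball y r" for b
      proof -
        have "continuous_on (cbox 0 1) (\<lambda>t. g (x + s * ?e t, b))"
        proof (rule continuous_on_compose2[OF cont])
          show "continuous_on (cbox 0 1) (\<lambda>t. (x + s * ?e t, b))"
            by (intro continuous_intros)
          show "(\<lambda>t. (x + s * ?e t, b)) ` cbox 0 1 \<subseteq> U"
            using in_U[OF e that] by blast
        qed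
        then show ?thesis
          using s by (intro integrable_continuous continuous_on_divide) (auto intro!: continuous_intros)
      qed
      show "continuous_on (ball y r \<times> cbox 0 1) (\<lambda>(b, t). partial2 g (x + s * ?e t, b) / (s * ?e t))"
      proof -
        have "continuous_on (ball y r \<times> cbox 0 1) (\<lambda>q. partial2 g (x + s * ?e (snd q), fst q))"
        proof (rule continuous_on_compose2[OF c2])
          show "continuous_on (ball y r \<times> cbox 0 1) (\<lambda>q. (x + s * ?e (snd q), fst q))"
            by (intro continuous_intros)
          show "(\<lambda>q. (x + s * ?e (snd q), fst q)) ` (ball y r \<times> cbox 0 1) \<subseteq> U"
            using in_U[OF e] by auto
        qed
        then show ?thesis
          unfolding split_beta
          using s by (intro continuous_on_divide) (auto intro!: continuous_intros)
      qed
    qed auto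
    then have "(\<lambda>b. partial1 g (x, b)) holomorphic_on ball y r"
    proof (rule holomorphic_transform)
      fix b assume b: "b \<in> ball y r"
      show "integral (cbox 0 1) (\<lambda>t. g (x + s * ?e t, b) / (s * ?e t)) = partial1 g (x, b)"
        unfolding partial1_def prod.case using s
        by (intro deriv_eq_circle_integral[symmetric] holomorphic_on_subset[OF hol[OF b]]) auto
    qed
    then show "(\<lambda>t. partial1 g (x, t)) field_differentiable at y"
      using r by (simp add: holomorphic_on_imp_differentiable_at)
  qed
  with c1 show ?thesis
    by (auto simp: sep_holomorphic_on_def)
qed

lemma holomorphic2_partial1:
  "open U \<Longrightarrow> holomorphic2_on g U \<Longrightarrow> holomorphic2_on (partial1 g) U"
  by (simp add: holomorphic2_imp_sep sep_holomorphic_partial1 sep_imp_holomorphic2)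

lemma holomorphic2_swap:
  assumes "holomorphic2_on g U"
  shows "holomorphic2_on (\<lambda>w. g (prod.swap w)) (prod.swap -` U)"
  unfolding holomorphic2_on_def
proof
  fix w assume "w \<in> prod.swap -` U"
  then obtain a b where ab: "(g has_derivative (\<lambda>(h, k). a * h + b * k)) (at (prod.swap w))"
    using assms unfolding holomorphic2_on_def by blast
  have "(prod.swap has_derivative prod.swap) (at w)"
    unfolding prod.swap_def by (auto intro!: derivative_eq_intros)
  from has_derivative_compose[OF this ab]
  show "\<exists>a b. ((\<lambda>w. g (prod.swap w)) has_derivative (\<lambda>(h, k). a * h + b * k)) (at w)"
    by - (rule exI[of _ b], rule exI[of _ a], simp add: case_prod_unfold add.commute)
qed

lemma holomorphic2_partial2:
  assumes "open U" "holomorphic2_on g U"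
  shows "holomorphic2_on (partial2 g) U"
proof -
  have "holomorphic2_on (partial1 (\<lambda>w. g (prod.swap w))) (prod.swap -` U)"
    using assms by (intro holomorphic2_partial1 open_swap_vimage holomorphic2_swap)
  from holomorphic2_swap[OF this] show ?thesis
    by (simp add: vimage_def flip: partial2_eq_partial1_swap)
qed

section \<open>Prolongations\<close>

lemma total_deriv1_eq: "total_deriv1 g j = partial1 g (source j) + snd (snd j) * partial2 g (source j)"
  by (simp add: total_deriv1_def partial1_def partial2_def source_def split_beta)

lemma partial_cong:
  assumes "open V" "w \<in> V" and eq: "\<And>v. v \<in> V \<Longrightarrow> g v = g' v"
  shows "partial1 g w = partial1 g' w" and "partial2 g w = partial2 g' w"
proof -
  obtain x y where w: "w = (x, y)" by (cases w)
  have "eventually (\<lambda>v. g v = g' v) (nhds (x, y))"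
    using assms w eventually_nhds by blast
  moreover have "((\<lambda>t. (t, y)) \<longlongrightarrow> (x, y)) (nhds x)" "((\<lambda>t. (x, t)) \<longlongrightarrow> (x, y)) (nhds y)"
    by (auto intro!: tendsto_eq_intros filterlim_ident)
  ultimately have "eventually (\<lambda>t. g (t, y) = g' (t, y)) (nhds x)"
    and "eventually (\<lambda>t. g (x, t) = g' (x, t)) (nhds y)"
    by (auto dest: eventually_compose_filterlim)
  then show "partial1 g w = partial1 g' w" "partial2 g w = partial2 g' w"
    by (auto simp: w partial1_def partial2_def intro!: deriv_cong_ev)
qed

lemma total_deriv2_cong:
  assumes "open N" "(x, y, p) \<in> N" and eq: "\<And>j. j \<in> N \<Longrightarrow> g j = g' j"
  shows "total_deriv2 g (x, y, p, q) = total_deriv2 g' (x, y, p, q)"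
proof -
  have "eventually (\<lambda>j. g j = g' j) (nhds (x, y, p))"
    using assms eventually_nhds by blast
  moreover have "((\<lambda>t. (t, y, p)) \<longlongrightarrow> (x, y, p)) (nhds x)" "((\<lambda>t. (x, t, p)) \<longlongrightarrow> (x, y, p)) (nhds y)"
    "((\<lambda>t. (x, y, t)) \<longlongrightarrow> (x, y, p)) (nhds p)"
    by (auto intro!: tendsto_eq_intros filterlim_ident)
  ultimately have "eventually (\<lambda>t. g (t, y, p) = g' (t, y, p)) (nhds x)"
    and "eventually (\<lambda>t. g (x, t, p) = g' (x, t, p)) (nhds y)"
    and "eventually (\<lambda>t. g (x, y, t) = g' (x, y, t)) (nhds p)"
    by (auto dest: eventually_compose_filterlim)
  then have "deriv (\<lambda>t. g (t, y, p)) x = deriv (\<lambda>t. g' (t, y, p)) x"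
    and "deriv (\<lambda>t. g (x, t, p)) y = deriv (\<lambda>t. g' (x, t, p)) y"
    and "deriv (\<lambda>t. g (x, y, t)) p = deriv (\<lambda>t. g' (x, y, t)) p"
    by (auto intro!: deriv_cong_ev)
  then show ?thesis
    by (simp add: total_deriv2_def)
qed

text \<open>\<open>total_deriv2\<close> is the derivative in the direction \<open>(1, p, q)\<close>.
  This reduces the chain rule for total derivatives to the ordinary one.\<close>

lemma total_deriv2_eq:
  assumes "(g has_derivative (\<lambda>(h, k, l). a * h + b * k + c * l)) (at (x, y, p))"
  shows "total_deriv2 g (x, y, p, q) = a + b * p + c * q"
proof -
  have "((\<lambda>t. g (t, y, p)) has_derivative (\<lambda>h. (\<lambda>(h, k, l). a * h + b * k + c * l) (h, 0, 0))) (at x)"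
    by (rule has_derivative_compose[where f = "\<lambda>t. (t, y, p)" and g = g])
      (use assms in \<open>auto intro!: derivative_eq_intros simp: zero_prod_def\<close>)
  then have 1: "((\<lambda>t. g (t, y, p)) has_field_derivative a) (at x)"
    by (simp add: has_field_derivative_def)
  have "((\<lambda>t. g (x, t, p)) has_derivative (\<lambda>k. (\<lambda>(h, k, l). a * h + b * k + c * l) (0, k, 0))) (at y)"
    by (rule has_derivative_compose[where f = "\<lambda>t. (x, t, p)" and g = g])
      (use assms in \<open>auto intro!: derivative_eq_intros simp: zero_prod_def\<close>)
  then have 2: "((\<lambda>t. g (x, t, p)) has_field_derivative b) (at y)"
    by (simp add: has_field_derivative_def)
  have "((\<lambda>t. g (x, y, t)) has_derivative (\<lambda>l. (\<lambda>(h, k, l). a * h + b * k + c * l) (0, 0, l))) (at p)"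
    by (rule has_derivative_compose[where f = "\<lambda>t. (x, y, t)" and g = g])
      (use assms in \<open>auto intro!: derivative_eq_intros simp: zero_prod_def\<close>)
  then have 3: "((\<lambda>t. g (x, y, t)) has_field_derivative c) (at p)"
    by (simp add: has_field_derivative_def)
  from 1 2 3 show ?thesis
    by (simp add: total_deriv2_def DERIV_imp_deriv algebra_simps)
qed

section \<open>Chain rules and the first prolongation of a composite\<close>

lemma holomorphic2_compose:
  assumes g: "holomorphic2_on g V" and \<phi>: "holomorphic_map_on \<phi> U" and "\<phi> ` U \<subseteq> V"
  shows "holomorphic2_on (\<lambda>w. g (\<phi> w)) U"
    and "w \<in> U \<Longrightarrow> partial1 (\<lambda>w. g (\<phi> w)) w =
      partial1 g (\<phi> w) * partial1 (\<lambda>w. fst (\<phi> w)) w + partial2 g (\<phi> w) * partial1 (\<lambda>w. snd (\<phi> w)) w"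
    and "w \<in> U \<Longrightarrow> partial2 (\<lambda>w. g (\<phi> w)) w =
      partial1 g (\<phi> w) * partial2 (\<lambda>w. fst (\<phi> w)) w + partial2 g (\<phi> w) * partial2 (\<lambda>w. snd (\<phi> w)) w"
proof -
  have *: "((\<lambda>w. g (\<phi> w)) has_derivative (\<lambda>(h, k).
      (partial1 g (\<phi> w) * partial1 (\<lambda>w. fst (\<phi> w)) w + partial2 g (\<phi> w) * partial1 (\<lambda>w. snd (\<phi> w)) w) * h +
      (partial1 g (\<phi> w) * partial2 (\<lambda>w. fst (\<phi> w)) w + partial2 g (\<phi> w) * partial2 (\<lambda>w. snd (\<phi> w)) w) * k)) (at w)"
    if "w \<in> U" for w
  proof -
    have 1: "((\<lambda>w. (fst (\<phi> w), snd (\<phi> w))) has_derivative (\<lambda>v.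
        ((\<lambda>(h, k). partial1 (\<lambda>w. fst (\<phi> w)) w * h + partial2 (\<lambda>w. fst (\<phi> w)) w * k) v,
         (\<lambda>(h, k). partial1 (\<lambda>w. snd (\<phi> w)) w * h + partial2 (\<lambda>w. snd (\<phi> w)) w * k) v))) (at w)"
      using \<phi> that unfolding holomorphic_map_on_def
      by (intro has_derivative_Pair holomorphic2_has_derivative) auto
    have 2: "(g has_derivative (\<lambda>(h, k). partial1 g (\<phi> w) * h + partial2 g (\<phi> w) * k)) (at (\<phi> w))"
      using assms that by (intro holomorphic2_has_derivative) auto
    show ?thesis
      by (rule has_derivative_eq_rhs[OF has_derivative_compose[OF 1[unfolded prod.collapse] 2]])
        (auto simp: algebra_simps)
  qed
  then show "holomorphic2_on (\<lambda>w. g (\<phi> w)) U"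
    unfolding holomorphic2_on_def by blast
  show "w \<in> U \<Longrightarrow> partial1 (\<lambda>w. g (\<phi> w)) w =
      partial1 g (\<phi> w) * partial1 (\<lambda>w. fst (\<phi> w)) w + partial2 g (\<phi> w) * partial1 (\<lambda>w. snd (\<phi> w)) w"
    using has_derivative_partials(3)[of _ _ _ "fst w" "snd w"] *[of w] by simp
  show "w \<in> U \<Longrightarrow> partial2 (\<lambda>w. g (\<phi> w)) w =
      partial1 g (\<phi> w) * partial2 (\<lambda>w. fst (\<phi> w)) w + partial2 g (\<phi> w) * partial2 (\<lambda>w. snd (\<phi> w)) w"
    using has_derivative_partials(4)[of _ _ _ "fst w" "snd w"] *[of w] by simp
qed

lemma holomorphic_map_compose:
  assumes "holomorphic_map_on \<psi> V" and "holomorphic_map_on \<phi> U" and "\<phi> ` U \<subseteq> V"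
  shows "holomorphic_map_on (\<lambda>w. \<psi> (\<phi> w)) U"
  using holomorphic2_compose(1)[OF _ assms(2,3)] assms(1)
  by (auto simp: holomorphic_map_on_def)

lemma holomorphic_map_continuous:
  assumes "holomorphic_map_on \<phi> U"
  shows "continuous_on U \<phi>"
proof -
  have "continuous_on U (\<lambda>w. fst (\<phi> w))" "continuous_on U (\<lambda>w. snd (\<phi> w))"
    using assms by (auto simp: holomorphic_map_on_def intro: holomorphic2_imp_continuous_on)
  from continuous_on_Pair[OF this] show ?thesis by simp
qed

lemma holomorphic2_subset: "holomorphic2_on g U \<Longrightarrow> V \<subseteq> U \<Longrightarrow> holomorphic2_on g V"
  by (auto simp: holomorphic2_on_def)

lemma holomorphic_map_subset: "holomorphic_map_on \<phi> U \<Longrightarrow> V \<subseteq> U \<Longrightarrow> holomorphic_map_on \<phi> V"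
  by (auto simp: holomorphic_map_on_def intro: holomorphic2_subset)

text \<open>The differential of \<phi> sends the direction \<open>(1, p)\<close> to
  \<open>(X, Y)\<close>, the total derivatives of the two components, and this is \<open>X\<close>
  times \<open>(1, p')\<close> with \<open>p'\<close> the prolonged slope.\<close>

lemma total_deriv1_compose:
  assumes "holomorphic2_on g V" and "holomorphic_map_on \<phi> U" and "\<phi> ` U \<subseteq> V"
    and "source j \<in> U" and nz: "total_deriv1 (\<lambda>w. fst (\<phi> w)) j \<noteq> 0"
  shows "total_deriv1 (\<lambda>w. g (\<phi> w)) j = total_deriv1 (\<lambda>w. fst (\<phi> w)) j * total_deriv1 g (prolong1 \<phi> j)"
proof -
  obtain x y p where j: "j = (x, y, p)" by (cases j)
  have "total_deriv1 (\<lambda>w. snd (\<phi> w)) j = total_deriv1 (\<lambda>w. fst (\<phi> w)) j * prolonged_slope \<phi> j"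
    using nz by (simp add: prolonged_slope_def)
  then have "total_deriv1 (\<lambda>w. fst (\<phi> w)) j * total_deriv1 g (prolong1 \<phi> j) =
      partial1 g (\<phi> (x, y)) * total_deriv1 (\<lambda>w. fst (\<phi> w)) j + partial2 g (\<phi> (x, y)) * total_deriv1 (\<lambda>w. snd (\<phi> w)) j"
    by (simp add: total_deriv1_eq[of g] j prolong1_def source_def algebra_simps)
  also have "\<dots> = total_deriv1 (\<lambda>w. g (\<phi> w)) j"
    using holomorphic2_compose(2,3)[OF assms(1-3), of "(x, y)"] \<open>source j \<in> U\<close>
    by (simp add: total_deriv1_eq j source_def algebra_simps)
  finally show ?thesis by simp
qed

text \<open>The 1-jets over \<open>U\<close> whose image direction is not vertical. Elsewhere the
  quotient in \<open>prolonged_slope\<close> is a division by zero, with the default value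
  0.\<close>

definition regular_jets :: "point set \<Rightarrow> (point \<Rightarrow> point) \<Rightarrow> jet1 set" where
  "regular_jets U \<phi> = {j. source j \<in> U \<and> total_deriv1 (\<lambda>w. fst (\<phi> w)) j \<noteq> 0}"

lemma source_prolong1 [simp]: "source (prolong1 \<phi> j) = \<phi> (source j)"
  by (simp add: source_def prolong1_def split_beta)

text \<open>Both components of \<psi> acquire the same factor from
  \<open>total_deriv1_compose\<close>, and it cancels in the slope.\<close>

lemma prolong1_compose:
  assumes "holomorphic_map_on \<psi> V" and "holomorphic_map_on \<phi> U" and "\<phi> ` U \<subseteq> V"
    and "j \<in> regular_jets U \<phi>"
  shows "total_deriv1 (\<lambda>w. fst (\<psi> (\<phi> w))) j =
      total_deriv1 (\<lambda>w. fst (\<phi> w)) j * total_deriv1 (\<lambda>w. fst (\<psi> w)) (prolong1 \<phi> j)"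
    and "prolonged_slope (\<lambda>w. \<psi> (\<phi> w)) j = prolonged_slope \<psi> (prolong1 \<phi> j)"
    and "prolong1 (\<lambda>w. \<psi> (\<phi> w)) j = prolong1 \<psi> (prolong1 \<phi> j)"
proof -
  have nz: "total_deriv1 (\<lambda>w. fst (\<phi> w)) j \<noteq> 0" and j: "source j \<in> U"
    using assms(4) by (auto simp: regular_jets_def)
  have "holomorphic2_on (\<lambda>w. fst (\<psi> w)) V" "holomorphic2_on (\<lambda>w. snd (\<psi> w)) V"
    using assms(1) by (auto simp: holomorphic_map_on_def)
  note * = this[THEN total_deriv1_compose[OF _ assms(2,3) j nz]]
  show "total_deriv1 (\<lambda>w. fst (\<psi> (\<phi> w))) j =
      total_deriv1 (\<lambda>w. fst (\<phi> w)) j * total_deriv1 (\<lambda>w. fst (\<psi> w)) (prolong1 \<phi> j)"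
    by (rule *)
  show s: "prolonged_slope (\<lambda>w. \<psi> (\<phi> w)) j = prolonged_slope \<psi> (prolong1 \<phi> j)"
    unfolding prolonged_slope_def[of "\<lambda>w. \<psi> (\<phi> w)"] * using nz by (simp add: prolonged_slope_def)
  show "prolong1 (\<lambda>w. \<psi> (\<phi> w)) j = prolong1 \<psi> (prolong1 \<phi> j)"
    using s by (simp add: prolong1_def split_beta)
qed

section \<open>Holomorphy of the first prolongation on the regular jets\<close>

lemma continuous_on_source [continuous_intros]: "continuous_on S source"
  unfolding source_def split_beta by (intro continuous_intros)

lemma open_source_vimage: "open U \<Longrightarrow> open (source -` U)"
  by (intro open_vimage continuous_intros)

lemma has_derivative_source: "(source has_derivative source) (at j)"
  unfolding source_def split_beta by (auto intro!: derivative_eq_intros)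

text \<open>The differential contains second partial derivatives of \<open>g\<close>; they exist
  because the first partial derivatives are holomorphic again.\<close>

lemma holomorphic3_total_deriv1:
  assumes "open U" and "holomorphic2_on g U"
  shows "holomorphic3_on (total_deriv1 g) (source -` U)"
  unfolding holomorphic3_on_def
proof
  fix j assume j: "j \<in> source -` U"
  let ?w = "source j"
  have "((\<lambda>j. partial1 g (source j)) has_derivative
      (\<lambda>v. (\<lambda>(h, k). partial1 (partial1 g) ?w * h + partial2 (partial1 g) ?w * k) (source v))) (at j)"
    by (rule has_derivative_compose[OF has_derivative_source holomorphic2_has_derivative[OF holomorphic2_partial1[OF assms]]])
      (use j in auto)
  moreover have "((\<lambda>j. partial2 g (source j)) has_derivative
      (\<lambda>v. (\<lambda>(h, k). partial1 (partial2 g) ?w * h + partial2 (partial2 g) ?w * k) (source v))) (at j)"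
    by (rule has_derivative_compose[OF has_derivative_source holomorphic2_has_derivative[OF holomorphic2_partial2[OF assms]]])
      (use j in auto)
  moreover have "((\<lambda>j::jet1. snd (snd j)) has_derivative (\<lambda>v. snd (snd v))) (at j)"
    by (auto intro!: derivative_eq_intros)
  ultimately have "(total_deriv1 g has_derivative (\<lambda>v.
      (\<lambda>(h, k). partial1 (partial1 g) ?w * h + partial2 (partial1 g) ?w * k) (source v) +
      (snd (snd j) * (\<lambda>(h, k). partial1 (partial2 g) ?w * h + partial2 (partial2 g) ?w * k) (source v) +
       snd (snd v) * partial2 g ?w))) (at j)"
    unfolding total_deriv1_eq[abs_def] by (intro has_derivative_add has_derivative_mult)
  then show "\<exists>a b c. (total_deriv1 g has_derivative (\<lambda>(h, k, l). a * h + b * k + c * l)) (at j)"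
    by - (rule exI[of _ "partial1 (partial1 g) ?w + snd (snd j) * partial1 (partial2 g) ?w"],
        rule exI[of _ "partial2 (partial1 g) ?w + snd (snd j) * partial2 (partial2 g) ?w"],
        rule exI[of _ "partial2 g ?w"],
        simp add: case_prod_unfold source_def algebra_simps)
qed

lemma holomorphic3_divide:
  assumes "holomorphic3_on F D" and "holomorphic3_on G D" and "\<And>j. j \<in> D \<Longrightarrow> G j \<noteq> 0"
  shows "holomorphic3_on (\<lambda>j. F j / G j) D"
  unfolding holomorphic3_on_def
proof
  fix j assume j: "j \<in> D"
  obtain a b c where F: "(F has_derivative (\<lambda>(h, k, l). a * h + b * k + c * l)) (at j)"
    using assms(1) j unfolding holomorphic3_on_def by blast
  obtain a' b' c' where G: "(G has_derivative (\<lambda>(h, k, l). a' * h + b' * k + c' * l)) (at j)"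
    using assms(2) j unfolding holomorphic3_on_def by blast
  have "((\<lambda>j. F j / G j) has_derivative (\<lambda>(h, k, l).
      (a * G j - F j * a') / (G j * G j) * h + (b * G j - F j * b') / (G j * G j) * k +
      (c * G j - F j * c') / (G j * G j) * l)) (at j)"
    by (rule has_derivative_eq_rhs[OF has_derivative_divide'[OF F G]])
      (use assms(3)[OF j] in \<open>auto simp: field_simps\<close>)
  then show "\<exists>a b c. ((\<lambda>j. F j / G j) has_derivative (\<lambda>(h, k, l). a * h + b * k + c * l)) (at j)"
    by blast
qed

lemma holomorphic3_imp_continuous_on: "holomorphic3_on g D \<Longrightarrow> continuous_on D g"
  unfolding holomorphic3_on_def by (meson continuous_at_imp_continuous_on has_derivative_continuous)

lemma holomorphic3_prolonged_slope:
  assumes "open U" and "holomorphic_map_on \<phi> U"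
  shows "holomorphic3_on (prolonged_slope \<phi>) (regular_jets U \<phi>)"
proof -
  have "holomorphic3_on (total_deriv1 (\<lambda>w. fst (\<phi> w))) (source -` U)"
    and "holomorphic3_on (total_deriv1 (\<lambda>w. snd (\<phi> w))) (source -` U)"
    using assms by (auto intro!: holomorphic3_total_deriv1 simp: holomorphic_map_on_def)
  then show ?thesis
    unfolding prolonged_slope_def[abs_def]
    by (intro holomorphic3_divide) (auto simp: regular_jets_def holomorphic3_on_def)
qed

lemma open_regular_jets:
  assumes "open U" and "holomorphic_map_on \<phi> U"
  shows "open (regular_jets U \<phi>)"
proof -
  have "continuous_on (source -` U) (total_deriv1 (\<lambda>w. fst (\<phi> w)))"
    using assms by (auto intro!: holomorphic3_imp_continuous_on holomorphic3_total_deriv1 simp: holomorphic_map_on_def)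
  then have "open (source -` U \<inter> total_deriv1 (\<lambda>w. fst (\<phi> w)) -` (- {0}))"
    using assms by (intro continuous_open_preimage open_source_vimage) auto
  also have "source -` U \<inter> total_deriv1 (\<lambda>w. fst (\<phi> w)) -` (- {0}) = regular_jets U \<phi>"
    by (auto simp: regular_jets_def)
  finally show ?thesis .
qed

lemma prolong1_eq: "prolong1 \<phi> j = (fst (\<phi> (source j)), snd (\<phi> (source j)), prolonged_slope \<phi> j)"
  by (simp add: prolong1_def source_def split_beta)

lemma continuous_on_prolong1:
  assumes "open U" and "holomorphic_map_on \<phi> U"
  shows "continuous_on (regular_jets U \<phi>) (prolong1 \<phi>)"
proof -
  have "continuous_on (regular_jets U \<phi>) (\<lambda>j. \<phi> (source j))"
    by (rule continuous_on_compose2[OF holomorphic_map_continuous[OF assms(2)] continuous_on_source])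
      (auto simp: regular_jets_def)
  then show ?thesis
    unfolding prolong1_eq[abs_def] using assms
    by (intro continuous_on_Pair continuous_on_fst continuous_on_snd
        holomorphic3_imp_continuous_on holomorphic3_prolonged_slope)
qed

section \<open>Chain rule for the second prolongation\<close>

lemma total_deriv2_compose:
  assumes \<phi>: "open U" "holomorphic_map_on \<phi> U" and j: "(x, y, p) \<in> regular_jets U \<phi>"
    and P: "(P has_derivative (\<lambda>(h, k, l). a * h + b * k + c * l)) (at (prolong1 \<phi> (x, y, p)))"
  shows "total_deriv2 (\<lambda>j. P (prolong1 \<phi> j)) (x, y, p, q) =
    a * total_deriv1 (\<lambda>w. fst (\<phi> w)) (x, y, p) + b * total_deriv1 (\<lambda>w. snd (\<phi> w)) (x, y, p) +
    c * total_deriv2 (prolonged_slope \<phi>) (x, y, p, q)"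
proof -
  let ?X = "\<lambda>w. fst (\<phi> w)" and ?Y = "\<lambda>w. snd (\<phi> w)" and ?w = "(x, y)"
  have w: "(x, y) \<in> U"
    using j by (simp add: regular_jets_def source_def)
  obtain s t u where S: "(prolonged_slope \<phi> has_derivative (\<lambda>(h, k, l). s * h + t * k + u * l)) (at (x, y, p))"
    using holomorphic3_prolonged_slope[OF \<phi>] j unfolding holomorphic3_on_def by blast
  have "(?X has_derivative (\<lambda>(h, k). partial1 ?X ?w * h + partial2 ?X ?w * k)) (at (source (x, y, p)))"
    and "(?Y has_derivative (\<lambda>(h, k). partial1 ?Y ?w * h + partial2 ?Y ?w * k)) (at (source (x, y, p)))"
    using \<phi> w by (auto intro!: holomorphic2_has_derivative simp: source_def holomorphic_map_on_def)
  note XY = this[THEN has_derivative_compose[OF has_derivative_source]]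
  \<comment> \<open>This differential sends the direction \<open>(1, p, q)\<close> to the vector of
    the total derivatives of the two components and of the slope. The claim evaluates the
    differential of \<open>P\<close> on that vector.\<close>
  have "(prolong1 \<phi> has_derivative (\<lambda>v.
      ((\<lambda>(h, k). partial1 ?X ?w * h + partial2 ?X ?w * k) (source v),
       (\<lambda>(h, k). partial1 ?Y ?w * h + partial2 ?Y ?w * k) (source v),
       (\<lambda>(h, k, l). s * h + t * k + u * l) v))) (at (x, y, p))"
    unfolding prolong1_eq[abs_def] by (intro has_derivative_Pair XY S)
  from has_derivative_compose[OF this P]
  have "((\<lambda>j. P (prolong1 \<phi> j)) has_derivative (\<lambda>(h, k, l).
      (a * partial1 ?X ?w + b * partial1 ?Y ?w + c * s) * h +
      (a * partial2 ?X ?w + b * partial2 ?Y ?w + c * t) * k + (c * u) * l)) (at (x, y, p))"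
    by (rule has_derivative_eq_rhs) (auto simp: source_def algebra_simps)
  from total_deriv2_eq[OF this, of q] total_deriv2_eq[OF S, of q] show ?thesis
    by (simp add: total_deriv1_eq source_def algebra_simps)
qed

lemma prolong2_eq:
  "prolong2 \<phi> (x, y, p, q) = (case prolong1 \<phi> (x, y, p) of (x', y', p') \<Rightarrow>
     (x', y', p', total_deriv2 (prolonged_slope \<phi>) (x, y, p, q) / total_deriv1 (\<lambda>w. fst (\<phi> w)) (x, y, p)))"
  by (simp add: prolong2_def prolong1_def)

text \<open>The vector \<open>(?X, ?Y, ?S)\<close> is \<open>?X\<close> times
  \<open>(1, p', ?S / ?X)\<close>, and \<open>?S / ?X\<close> is the second derivative assigned by
  \<open>prolong2 \<phi>\<close>. The factor \<open>?X\<close> cancels against the one in the total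
  derivative of the first component of the composite.\<close>

lemma prolong2_compose:
  assumes \<psi>: "open V" "holomorphic_map_on \<psi> V" and \<phi>: "open U" "holomorphic_map_on \<phi> U" and sub: "\<phi> ` U \<subseteq> V"
    and j: "(x, y, p) \<in> regular_jets U \<phi>" and j': "prolong1 \<phi> (x, y, p) \<in> regular_jets V \<psi>"
  shows "prolong2 (\<lambda>w. \<psi> (\<phi> w)) (x, y, p, q) = prolong2 \<psi> (prolong2 \<phi> (x, y, p, q))"
proof -
  let ?X = "total_deriv1 (\<lambda>w. fst (\<phi> w)) (x, y, p)"
  let ?Y = "total_deriv1 (\<lambda>w. snd (\<phi> w)) (x, y, p)"
  let ?S = "total_deriv2 (prolonged_slope \<phi>) (x, y, p, q)"
  obtain x' y' p' where j'_eq: "prolong1 \<phi> (x, y, p) = (x', y', p')"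
    by (metis prod_cases3)
  have X: "?X \<noteq> 0"
    using j by (simp add: regular_jets_def)
  obtain a b c where P: "(prolonged_slope \<psi> has_derivative (\<lambda>(h, k, l). a * h + b * k + c * l)) (at (x', y', p'))"
    using holomorphic3_prolonged_slope[OF \<psi>] j' j'_eq unfolding holomorphic3_on_def by fastforce
  \<comment> \<open>Derivatives see only germs, so the slope of the composite may be replaced by its
    formula on the open set of regular jets.\<close>
  have "total_deriv2 (prolonged_slope (\<lambda>w. \<psi> (\<phi> w))) (x, y, p, q) =
      total_deriv2 (\<lambda>j. prolonged_slope \<psi> (prolong1 \<phi> j)) (x, y, p, q)"
    by (rule total_deriv2_cong[OF open_regular_jets[OF \<phi>] j prolong1_compose(2)[OF \<psi>(2) \<phi>(2) sub]])
  also have "\<dots> = a * ?X + b * ?Y + c * ?S"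
    by (rule total_deriv2_compose[OF \<phi> j]) (use P j'_eq in simp)
  also have "\<dots> = ?X * (a + b * p' + c * (?S / ?X))"
  proof -
    have "p' = ?Y / ?X"
      using j'_eq by (simp add: prolong1_def prolonged_slope_def)
    then show ?thesis
      using X by (simp add: field_simps)
  qed
  also have "\<dots> = ?X * total_deriv2 (prolonged_slope \<psi>) (x', y', p', ?S / ?X)"
    by (simp add: total_deriv2_eq[OF P])
  finally have "total_deriv2 (prolonged_slope (\<lambda>w. \<psi> (\<phi> w))) (x, y, p, q) =
      ?X * total_deriv2 (prolonged_slope \<psi>) (x', y', p', ?S / ?X)" .
  with X show ?thesis
    by (simp add: prolong2_eq prolong1_compose[OF \<psi>(2) \<phi>(2) sub j] j'_eq split_beta)
qed

text \<open>Prolongations depend only on the germ. This serves for the identity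
  \<open>\<psi> (\<phi> w) = w\<close>, which is known on \<open>U\<close> alone.\<close>

lemma prolong_cong:
  assumes V: "open V" and eq: "\<And>w. w \<in> V \<Longrightarrow> \<phi> w = \<phi>' w" and j: "source (x, y, p) \<in> V"
  shows "total_deriv1 (\<lambda>w. fst (\<phi> w)) (x, y, p) = total_deriv1 (\<lambda>w. fst (\<phi>' w)) (x, y, p)"
    and "prolong1 \<phi> (x, y, p) = prolong1 \<phi>' (x, y, p)"
    and "prolong2 \<phi> (x, y, p, q) = prolong2 \<phi>' (x, y, p, q)"
proof -
  have 1: "total_deriv1 (\<lambda>w. fst (\<phi> w)) j = total_deriv1 (\<lambda>w. fst (\<phi>' w)) j"
    "total_deriv1 (\<lambda>w. snd (\<phi> w)) j = total_deriv1 (\<lambda>w. snd (\<phi>' w)) j" if "source j \<in> V" for j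
    using eq partial_cong[OF V that, of "\<lambda>w. fst (\<phi> w)" "\<lambda>w. fst (\<phi>' w)"]
      partial_cong[OF V that, of "\<lambda>w. snd (\<phi> w)" "\<lambda>w. snd (\<phi>' w)"]
    by (auto simp: total_deriv1_eq)
  then have 2: "prolonged_slope \<phi> j = prolonged_slope \<phi>' j" if "source j \<in> V" for j
    using that by (simp add: prolonged_slope_def)
  show "total_deriv1 (\<lambda>w. fst (\<phi> w)) (x, y, p) = total_deriv1 (\<lambda>w. fst (\<phi>' w)) (x, y, p)"
    using 1 j by blast
  show p1: "prolong1 \<phi> (x, y, p) = prolong1 \<phi>' (x, y, p)"
    using 2[OF j] eq[OF j] by (simp add: prolong1_eq)
  have "total_deriv2 (prolonged_slope \<phi>) (x, y, p, q) = total_deriv2 (prolonged_slope \<phi>') (x, y, p, q)"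
    by (rule total_deriv2_cong[OF open_source_vimage[OF V]]) (use 2 j in auto)
  with p1 1(1)[OF j] show "prolong2 \<phi> (x, y, p, q) = prolong2 \<phi>' (x, y, p, q)"
    by (simp add: prolong2_eq)
qed

lemma prolong_ident:
  "total_deriv1 (\<lambda>w. fst w) j = 1" "prolong1 (\<lambda>w. w) j = j" "prolong2 (\<lambda>w. w) j2 = j2"
proof -
  have 1: "total_deriv1 (\<lambda>w. fst w) = (\<lambda>_. 1)" "total_deriv1 (\<lambda>w. snd w) = (\<lambda>(x, y, p). p)"
    by (auto simp: total_deriv1_def fun_eq_iff)
  then have 2: "prolonged_slope (\<lambda>w. w) = (\<lambda>(x, y, p). p)"
    by (auto simp: prolonged_slope_def fun_eq_iff)
  show "total_deriv1 (\<lambda>w. fst w) j = 1" "prolong1 (\<lambda>w. w) j = j" "prolong2 (\<lambda>w. w) j2 = j2"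
    by (auto simp: 1 2 prolong1_def prolong2_def total_deriv2_def split_beta)
qed

section \<open>Taylor series\<close>

text \<open>Identifies the inner derivatives in \<open>taylor\<close> with iterates of
  \<open>partial2\<close>, whose holomorphy in both variables is available.\<close>

lemma funpow_partial2: "(partial2 ^^ j) g (x, y) = (deriv ^^ j) (\<lambda>t. g (x, t)) y"
proof (induction j arbitrary: y)
  case (Suc j)
  have "(partial2 ^^ Suc j) g (x, y) = deriv (\<lambda>t. (partial2 ^^ j) g (x, t)) y"
    by (simp add: partial2_def)
  then show ?case
    by (simp add: Suc.IH)
qed simp

lemma holomorphic2_funpow_partial2:
  "open U \<Longrightarrow> holomorphic2_on g U \<Longrightarrow> holomorphic2_on ((partial2 ^^ j) g) U"
  by (induction j) (auto intro: holomorphic2_partial2)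

lemma holomorphic2_sections:
  assumes "holomorphic2_on g (A \<times> B)"
  shows "y \<in> B \<Longrightarrow> (\<lambda>t. g (t, y)) holomorphic_on A" and "x \<in> A \<Longrightarrow> (\<lambda>t. g (x, t)) holomorphic_on B"
  using holomorphic2_imp_sep[OF assms]
  by (auto simp: sep_holomorphic_on_def holomorphic_on_def intro: field_differentiable_at_within)

text \<open>The identity theorem in one variable is applied twice: in \<open>x\<close> to the
  iterated \<open>y\<close>-derivatives along the line \<open>y = y\<^sub>0\<close>, then in
  \<open>y\<close> on each vertical line, where the Taylor coefficients agree by the first
  application.\<close>

lemma holomorphic2_eq_near:
  assumes U: "open U" and g: "holomorphic2_on g U" and h: "holomorphic2_on h U" and w: "(x\<^sub>0, y\<^sub>0) \<in> U"
    and eq: "\<And>i j. (deriv ^^ i) (\<lambda>x. (deriv ^^ j) (\<lambda>y. g (x, y)) y\<^sub>0) x\<^sub>0 =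
      (deriv ^^ i) (\<lambda>x. (deriv ^^ j) (\<lambda>y. h (x, y)) y\<^sub>0) x\<^sub>0"
  shows "\<forall>\<^sub>F w in nhds (x\<^sub>0, y\<^sub>0). g w = h w"
proof -
  obtain r where r: "0 < r" "ball x\<^sub>0 r \<times> ball y\<^sub>0 r \<subseteq> U"
    using open_contains_ball_Times[OF U w] .
  let ?A = "ball x\<^sub>0 r" and ?B = "ball y\<^sub>0 r"
  have hol: "holomorphic2_on ((partial2 ^^ j) g) (?A \<times> ?B)" "holomorphic2_on ((partial2 ^^ j) h) (?A \<times> ?B)" for j
    using holomorphic2_funpow_partial2[OF U] g h r by (blast intro: holomorphic2_subset)+
  have "g (x, y) = h (x, y)" if xy: "x \<in> ?A" "y \<in> ?B" for x y
  proof (rule holomorphic_fun_eq_on_ball[where z = y\<^sub>0 and r = r and w = y])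
    show "(\<lambda>t. g (x, t)) holomorphic_on ?B" "(\<lambda>t. h (x, t)) holomorphic_on ?B"
      using holomorphic2_sections(2)[OF hol(1)[of 0]] holomorphic2_sections(2)[OF hol(2)[of 0]] xy by auto
    fix j
    have "(partial2 ^^ j) g (x, y\<^sub>0) = (partial2 ^^ j) h (x, y\<^sub>0)"
    proof (rule holomorphic_fun_eq_on_ball[where z = x\<^sub>0 and r = r and w = x])
      show "(\<lambda>t. (partial2 ^^ j) g (t, y\<^sub>0)) holomorphic_on ?A" "(\<lambda>t. (partial2 ^^ j) h (t, y\<^sub>0)) holomorphic_on ?A"
        using r by (auto intro!: holomorphic2_sections(1)[OF hol(1)] holomorphic2_sections(1)[OF hol(2)])
    qed (use xy eq in \<open>auto simp: funpow_partial2\<close>)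
    then show "(deriv ^^ j) (\<lambda>t. g (x, t)) y\<^sub>0 = (deriv ^^ j) (\<lambda>t. h (x, t)) y\<^sub>0"
      by (simp add: funpow_partial2)
  qed (use xy in auto)
  then show ?thesis
    unfolding eventually_nhds using r by (intro exI[of _ "?A \<times> ?B"]) (auto intro!: open_Times)
qed

lemma taylor_eq_imp_eq_near:
  assumes U: "open U" "w \<in> U" and hol: "holomorphic_map_on \<sigma> U" "holomorphic_map_on \<tau> U"
    and eq: "taylor \<sigma> w = taylor \<tau> w"
  shows "\<forall>\<^sub>F v in nhds w. \<sigma> v = \<tau> v"
proof -
  obtain x y where w: "w = (x, y)" by (cases w)
  have "\<forall>\<^sub>F v in nhds w. fst (\<sigma> v) = fst (\<tau> v)" "\<forall>\<^sub>F v in nhds w. snd (\<sigma> v) = snd (\<tau> v)"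
    unfolding w
    by (rule holomorphic2_eq_near[OF U(1)];
        use assms in \<open>simp add: w holomorphic_map_on_def taylor_def fun_eq_iff\<close>)+
  then show ?thesis
    by eventually_elim (simp add: prod_eq_iff)
qed

text \<open>On a box where \<sigma> and \<tau> coincide, the inner derivatives agree for all
  \<open>x\<close> near \<open>x0\<close>; hence the outer derivatives agree at
  \<open>x0\<close>.\<close>

lemma taylor_cong:
  assumes "\<forall>\<^sub>F v in nhds w. \<sigma> v = \<tau> v"
  shows "taylor \<sigma> w = taylor \<tau> w"
proof -
  obtain x0 y0 where w: "w = (x0, y0)" by (cases w)
  obtain V where V: "open V" "(x0, y0) \<in> V" "\<And>v. v \<in> V \<Longrightarrow> \<sigma> v = \<tau> v"
    using assms unfolding eventually_nhds w by blast
  obtain r where r: "0 < r" "ball x0 r \<times> ball y0 r \<subseteq> V"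
    using open_contains_ball_Times[OF V(1,2)] .
  have eq: "\<sigma> (x, y) = \<tau> (x, y)" if "x \<in> ball x0 r" "y \<in> ball y0 r" for x y
    using that r V(3) by blast
  have near: "\<forall>\<^sub>F y in nhds y0. y \<in> ball y0 r" "\<forall>\<^sub>F x in nhds x0. x \<in> ball x0 r"
    using r by (auto intro!: eventually_nhds_in_open simp del: mem_ball)
  have "(deriv ^^ i) (\<lambda>x. (deriv ^^ j) (\<lambda>y. f (\<sigma> (x, y))) y0) x0 =
      (deriv ^^ i) (\<lambda>x. (deriv ^^ j) (\<lambda>y. f (\<tau> (x, y))) y0) x0" for i j and f :: "point \<Rightarrow> complex"
  proof (rule higher_deriv_cong_ev)
    show "\<forall>\<^sub>F x in nhds x0. (deriv ^^ j) (\<lambda>y. f (\<sigma> (x, y))) y0 = (deriv ^^ j) (\<lambda>y. f (\<tau> (x, y))) y0"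
      using near(2)
    proof eventually_elim
      case (elim x)
      show ?case
        by (rule higher_deriv_cong_ev)
          (use near(1) elim in \<open>auto elim!: eventually_mono simp: eq simp del: mem_ball\<close>)
    qed
  qed simp
  then show ?thesis
    by (simp add: w taylor_def)
qed

section \<open>Local transformations\<close>

lemma local_transformation_obtain_inverse:
  assumes "local_transformation U \<phi>"
  obtains \<psi> where "local_transformation (\<phi> ` U) \<psi>" and "\<And>w. w \<in> U \<Longrightarrow> \<psi> (\<phi> w) = w"
proof -
  obtain \<psi> where \<psi>: "holomorphic_map_on \<psi> (\<phi> ` U)" "\<And>w. w \<in> U \<Longrightarrow> \<psi> (\<phi> w) = w"
    using assms by (auto simp: local_transformation_def)
  then have "\<psi> ` \<phi> ` U = U"
    by force
  then have "local_transformation (\<phi> ` U) \<psi>"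
    using assms \<psi> by (auto simp: local_transformation_def intro!: exI[of _ \<phi>])
  with \<psi> that show thesis by blast
qed

lemma local_transformation_continuous: "local_transformation U \<phi> \<Longrightarrow> continuous_on U \<phi>"
  by (simp add: local_transformation_def holomorphic_map_continuous)

lemma local_transformation_inj: "local_transformation U \<phi> \<Longrightarrow> inj_on \<phi> U"
  by (metis local_transformation_obtain_inverse inj_on_inverseI)

text \<open>The image of \<open>V\<close> is the preimage of \<open>V\<close> under the inverse,
  which is continuous on the open image of \<open>U\<close>; hence it is open.\<close>

lemma local_transformation_subset:
  assumes "local_transformation U \<phi>" and "open V" and "V \<subseteq> U"
  shows "local_transformation V \<phi>"
proof -
  obtain \<psi> where \<psi>: "local_transformation (\<phi> ` U) \<psi>" "\<And>w. w \<in> U \<Longrightarrow> \<psi> (\<phi> w) = w"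
    using local_transformation_obtain_inverse[OF assms(1)] by blast
  have "open (\<phi> ` U \<inter> \<psi> -` V)"
    using assms \<psi> by (intro continuous_open_preimage local_transformation_continuous)
      (auto simp: local_transformation_def)
  also have "\<phi> ` U \<inter> \<psi> -` V = \<phi> ` V"
    using \<psi>(2) assms(3) by force
  finally have "open (\<phi> ` V)" .
  moreover have "holomorphic_map_on \<psi> (\<phi> ` V)"
    using \<psi>(1) assms(3) by (auto simp: local_transformation_def intro: holomorphic_map_subset)
  moreover have "\<forall>w\<in>V. \<psi> (\<phi> w) = w"
    using assms(3) \<psi>(2) by blast
  moreover have "holomorphic_map_on \<phi> V"
    using assms by (auto simp: local_transformation_def intro: holomorphic_map_subset)
  ultimately show ?thesis
    using assms(2) unfolding local_transformation_def by blast
qed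

lemma local_transformation_compose:
  assumes \<phi>: "local_transformation U \<phi>" and \<psi>: "local_transformation V \<psi>" and sub: "\<phi> ` U \<subseteq> V"
  shows "local_transformation U (\<lambda>w. \<psi> (\<phi> w))"
proof -
  have \<psi>U: "local_transformation (\<phi> ` U) \<psi>"
    using local_transformation_subset[OF \<psi> _ sub] \<phi> by (simp add: local_transformation_def)
  obtain \<phi>' where \<phi>': "local_transformation (\<phi> ` U) \<phi>'" "\<And>w. w \<in> U \<Longrightarrow> \<phi>' (\<phi> w) = w"
    using local_transformation_obtain_inverse[OF \<phi>] by blast
  obtain \<psi>' where \<psi>': "local_transformation (\<psi> ` \<phi> ` U) \<psi>'" "\<And>w. w \<in> \<phi> ` U \<Longrightarrow> \<psi>' (\<psi> w) = w"
    using local_transformation_obtain_inverse[OF \<psi>U] by blast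
  have "holomorphic_map_on (\<lambda>w. \<psi> (\<phi> w)) U"
    using \<phi> \<psi> sub by (auto simp: local_transformation_def intro: holomorphic_map_compose)
  moreover have "holomorphic_map_on (\<lambda>w. \<phi>' (\<psi>' w)) (\<psi> ` \<phi> ` U)"
  proof (rule holomorphic_map_compose[of \<phi>' "\<phi> ` U" \<psi>'])
    show "\<psi>' ` \<psi> ` \<phi> ` U \<subseteq> \<phi> ` U"
      using \<psi>'(2) by force
  qed (use \<phi>'(1) \<psi>'(1) in \<open>simp_all add: local_transformation_def\<close>)
  moreover have "\<forall>w\<in>U. \<phi>' (\<psi>' (\<psi> (\<phi> w))) = w"
    by (simp add: \<phi>'(2) \<psi>'(2))
  moreover have "open U" "open (\<psi> ` \<phi> ` U)"
    using \<phi> \<psi>U by (auto simp: local_transformation_def)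
  ultimately show ?thesis
    unfolding local_transformation_def image_image by blast
qed

section \<open>Forms of composites and inverses\<close>

lemma has_form_subset: "has_form \<Phi> U \<phi> \<Longrightarrow> V \<subseteq> U \<Longrightarrow> has_form \<Phi> V \<phi>"
  by (cases \<Phi>) (simp_all, blast+)

lemma has_form_compose:
  assumes \<phi>: "has_form \<Phi> U \<phi>" and \<psi>: "has_form \<Phi> V \<psi>" and sub: "\<phi> ` U \<subseteq> V"
  shows "has_form \<Phi> U (\<lambda>w. \<psi> (\<phi> w))"
proof -
  have V: "(fst (\<phi> (x, y)), snd (\<phi> (x, y))) \<in> V" if "(x, y) \<in> U" for x y
    using that sub by auto
  show ?thesis
  proof (cases \<Phi>)
    case Phi3
    then obtain C C' where "\<forall>(x, y)\<in>U. fst (\<phi> (x, y)) = x + C" "\<forall>(x, y)\<in>V. fst (\<psi> (x, y)) = x + C'"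
      using \<phi> \<psi> by auto
    with Phi3 show ?thesis
      using V by (fastforce intro!: exI[of _ "C + C'"])
  next
    case Phi4
    then obtain C C' where "\<forall>(x, y)\<in>U. snd (\<phi> (x, y)) = y + C" "\<forall>(x, y)\<in>V. snd (\<psi> (x, y)) = y + C'"
      using \<phi> \<psi> by auto
    with Phi4 show ?thesis
      using V by (fastforce intro!: exI[of _ "C + C'"])
  next
    case Phi5
    then obtain \<xi> \<xi>' where "\<forall>(x, y)\<in>U. fst (\<phi> (x, y)) = \<xi> x" "\<forall>(x, y)\<in>V. fst (\<psi> (x, y)) = \<xi>' x"
      using \<phi> \<psi> by auto
    with Phi5 show ?thesis
      using V by (fastforce intro!: exI[of _ "\<lambda>x. \<xi>' (\<xi> x)"])
  next
    case Phi6
    then obtain \<xi> \<xi>' where "\<forall>(x, y)\<in>U. snd (\<phi> (x, y)) = \<xi> y" "\<forall>(x, y)\<in>V. snd (\<psi> (x, y)) = \<xi>' y"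
      using \<phi> \<psi> by auto
    with Phi6 show ?thesis
      using V by (fastforce intro!: exI[of _ "\<lambda>x. \<xi>' (\<xi> x)"])
  qed (use \<phi> \<psi> V in fastforce)+
qed

lemma partials_fst_snd [simp]:
  "partial1 fst w = 1" "partial2 fst w = 0" "partial1 snd w = 0" "partial2 snd w = 1"
  by (simp_all add: partial1_def partial2_def split_beta)

text \<open>Chain rule for \<open>\<psi> (\<phi> w) = w\<close>. If the \<open>y\<close>-derivative
  of the first component of \<phi> vanishes, the second component of the identity makes the
  \<open>y\<close>-derivative of the second component of \<phi> nonzero, and the first component of
  the identity then gives the claim. The other statement is the mirror image.\<close>

lemma inverse_partials:
  assumes \<phi>: "local_transformation U \<phi>" and \<psi>: "holomorphic_map_on \<psi> (\<phi> ` U)"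
    and inv: "\<And>w. w \<in> U \<Longrightarrow> \<psi> (\<phi> w) = w" and w: "w \<in> U"
  shows "partial2 (\<lambda>w. fst (\<phi> w)) w = 0 \<Longrightarrow> partial2 (\<lambda>w. fst (\<psi> w)) (\<phi> w) = 0"
    and "partial1 (\<lambda>w. snd (\<phi> w)) w = 0 \<Longrightarrow> partial1 (\<lambda>w. snd (\<psi> w)) (\<phi> w) = 0"
proof -
  have U: "open U" and hol: "holomorphic_map_on \<phi> U"
    using \<phi> by (auto simp: local_transformation_def)
  have h: "holomorphic2_on (\<lambda>w. fst (\<psi> w)) (\<phi> ` U)" "holomorphic2_on (\<lambda>w. snd (\<psi> w)) (\<phi> ` U)"
    using \<psi> by (auto simp: holomorphic_map_on_def)
  note c = partial_cong[OF U w, of "\<lambda>w. fst (\<psi> (\<phi> w))" fst] partial_cong[OF U w, of "\<lambda>w. snd (\<psi> (\<phi> w))" snd]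
  note d = holomorphic2_compose(2,3)[OF h(1) hol order_refl w] holomorphic2_compose(2,3)[OF h(2) hol order_refl w]
  show "partial2 (\<lambda>w. fst (\<psi> w)) (\<phi> w) = 0" if "partial2 (\<lambda>w. fst (\<phi> w)) w = 0"
    using c d that by (auto simp: inv)
  show "partial1 (\<lambda>w. snd (\<psi> w)) (\<phi> w) = 0" if "partial1 (\<lambda>w. snd (\<phi> w)) w = 0"
    using c d that by (auto simp: inv)
qed

lemma partial2_zero_imp_eq:
  assumes g: "holomorphic2_on g (A \<times> B)" and "convex B" and zero: "\<And>w. w \<in> A \<times> B \<Longrightarrow> partial2 g w = 0"
    and "x \<in> A" "y \<in> B" "y' \<in> B"
  shows "g (x, y) = g (x, y')"
proof (rule has_field_derivative_zero_constant[OF \<open>convex B\<close>, of "\<lambda>t. g (x, t)", THEN exE])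
  show "((\<lambda>t. g (x, t)) has_field_derivative 0) (at t within B)" if "t \<in> B" for t
    using has_derivative_partials(2)[OF holomorphic2_has_derivative[OF g, of "(x, t)"]] zero that \<open>x \<in> A\<close>
    by (auto intro: has_field_derivative_at_within)
qed (use assms in auto)

lemma partial1_zero_imp_eq:
  assumes g: "holomorphic2_on g (A \<times> B)" and "convex A" and zero: "\<And>w. w \<in> A \<times> B \<Longrightarrow> partial1 g w = 0"
    and "x \<in> A" "x' \<in> A" "y \<in> B"
  shows "g (x, y) = g (x', y)"
proof (rule has_field_derivative_zero_constant[OF \<open>convex A\<close>, of "\<lambda>t. g (t, y)", THEN exE])
  show "((\<lambda>t. g (t, y)) has_field_derivative 0) (at t within A)" if "t \<in> A" for t
    using has_derivative_partials(1)[OF holomorphic2_has_derivative[OF g, of "(t, y)"]] zero that \<open>y \<in> B\<close>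
    by (auto intro: has_field_derivative_at_within)
qed (use assms in auto)

text \<open>For \<open>\<Phi>\<^sub>5\<close> and \<open>\<Phi>\<^sub>6\<close> the form is inherited by the inverse only locally: \<open>\<xi>\<close> need not be injective
  on the projection of \<open>U\<close>, although \<open>\<phi>\<close> is injective on \<open>U\<close>.\<close>

lemma has_form_inverse:
  assumes \<phi>: "local_transformation U \<phi>" and form: "has_form \<Phi> U \<phi>"
    and \<psi>: "holomorphic_map_on \<psi> (\<phi> ` U)" and inv: "\<And>w. w \<in> U \<Longrightarrow> \<psi> (\<phi> w) = w" and w: "w \<in> U"
  obtains V where "open V" "\<phi> w \<in> V" "V \<subseteq> \<phi> ` U" "has_form \<Phi> V \<psi>"
proof -
  obtain x0 y0 where w': "\<phi> w = (x0, y0)" by (cases "\<phi> w")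
  have U: "open U" "open (\<phi> ` U)"
    using \<phi> by (auto simp: local_transformation_def)
  obtain r where r: "0 < r" "ball x0 r \<times> ball y0 r \<subseteq> \<phi> ` U"
    using open_contains_ball_Times[OF U(2)] w w' by (metis imageI)
  let ?A = "ball x0 r" and ?B = "ball y0 r"
  have h: "holomorphic2_on (\<lambda>w. fst (\<psi> w)) (?A \<times> ?B)" "holomorphic2_on (\<lambda>w. snd (\<psi> w)) (?A \<times> ?B)"
    using \<psi> r by (auto simp: holomorphic_map_on_def intro: holomorphic2_subset)
  have pre: "\<exists>u\<in>U. \<phi> u = v \<and> \<psi> v = u" if "v \<in> ?A \<times> ?B" for v
    using that r inv by force
  have "has_form \<Phi> (?A \<times> ?B) \<psi>"
  proof (cases \<Phi>)
    case Phi3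
    then obtain C where "\<forall>(x, y)\<in>U. fst (\<phi> (x, y)) = x + C"
      using form by auto
    then have "fst (\<psi> v) = fst v + - C" if "v \<in> ?A \<times> ?B" for v
      using pre[OF that] by force
    with Phi3 show ?thesis by (force intro!: exI[of _ "- C"])
  next
    case Phi4
    then obtain C where "\<forall>(x, y)\<in>U. snd (\<phi> (x, y)) = y + C"
      using form by auto
    then have "snd (\<psi> v) = snd v + - C" if "v \<in> ?A \<times> ?B" for v
      using pre[OF that] by force
    with Phi4 show ?thesis by (force intro!: exI[of _ "- C"])
  next
    case Phi5
    then obtain \<xi> where \<xi>: "\<forall>(x, y)\<in>U. fst (\<phi> (x, y)) = \<xi> x"
      using form by auto
    \<comment> \<open>\<xi> is an arbitrary function, but along the \<open>y\<close>-direction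
      \<open>\<xi> x\<close> is constant, so the derivative is zero. The inverse inherits this
      through \<open>inverse_partials\<close>.\<close>
    have "partial2 (\<lambda>w. fst (\<phi> w)) u = 0" if "u \<in> U" for u
      using partial_cong(2)[OF U(1) that, of "\<lambda>w. fst (\<phi> w)" "\<lambda>w. \<xi> (fst w)"] \<xi>
      by (auto simp: partial2_def case_prod_unfold)
    then have zero: "partial2 (\<lambda>w. fst (\<psi> w)) v = 0" if "v \<in> ?A \<times> ?B" for v
      using pre[OF that] inverse_partials(1)[OF \<phi> \<psi> inv] by blast
    \<comment> \<open>In a box the vertical fibres are convex, so the first component of \<psi>
      depends on \<open>x\<close> alone; the slice \<open>y = y0\<close> supplies the new
      \<xi>.\<close>
    have "fst (\<psi> (x, y)) = fst (\<psi> (x, y0))" if "x \<in> ?A" "y \<in> ?B" for x y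
      by (rule partial2_zero_imp_eq[OF h(1) convex_ball zero]) (use that r in auto)
    with Phi5 show ?thesis by (auto intro!: exI[of _ "\<lambda>x. fst (\<psi> (x, y0))"])
  next
    case Phi6
    then obtain \<xi> where \<xi>: "\<forall>(x, y)\<in>U. snd (\<phi> (x, y)) = \<xi> y"
      using form by auto
    have "partial1 (\<lambda>w. snd (\<phi> w)) u = 0" if "u \<in> U" for u
      using partial_cong(1)[OF U(1) that, of "\<lambda>w. snd (\<phi> w)" "\<lambda>w. \<xi> (snd w)"] \<xi>
      by (auto simp: partial1_def case_prod_unfold)
    then have zero: "partial1 (\<lambda>w. snd (\<psi> w)) v = 0" if "v \<in> ?A \<times> ?B" for v
      using pre[OF that] inverse_partials(2)[OF \<phi> \<psi> inv] by blast
    have "snd (\<psi> (x, y)) = snd (\<psi> (x0, y))" if "x \<in> ?A" "y \<in> ?B" for x y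
      by (rule partial1_zero_imp_eq[OF h(2) convex_ball zero]) (use that r in auto)
    with Phi6 show ?thesis by (auto intro!: exI[of _ "\<lambda>y. snd (\<psi> (x0, y))"])
  next
    case Phi1
    then have "fst (\<psi> v) = fst v" if "v \<in> ?A \<times> ?B" for v
      using pre[OF that] form by force
    with Phi1 show ?thesis by force
  next
    case Phi2
    then have "snd (\<psi> v) = snd v" if "v \<in> ?A \<times> ?B" for v
      using pre[OF that] form by force
    with Phi2 show ?thesis by force
  qed simp
  with r w' show thesis
    by (intro that[of "?A \<times> ?B"]) (auto intro!: open_Times)
qed

section \<open>Transformations between equations\<close>

text \<open>The last clause records that mapping one equation to another is an open condition on the
  1-jet, which allows the base jet to be moved within \<open>N\<close>.\<close>

lemma maps_equationE:
  assumes "maps_equation \<phi> z E E'"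
  obtains N where "open N" and "z \<in> N"
    and "\<And>j. j \<in> N \<Longrightarrow> total_deriv1 (\<lambda>w. fst (\<phi> w)) j \<noteq> 0"
    and "\<And>x y p q. (x, y, p) \<in> N \<Longrightarrow> (x, y, p, q) \<in> E \<longleftrightarrow> prolong2 \<phi> (x, y, p, q) \<in> E'"
    and "\<And>j. j \<in> N \<Longrightarrow> maps_equation \<phi> j E E'"
proof -
  obtain N where N: "open N" "z \<in> N"
    "\<forall>(x, y, p)\<in>N. total_deriv1 (\<lambda>w. fst (\<phi> w)) (x, y, p) \<noteq> 0 \<and>
      (\<forall>q. (x, y, p, q) \<in> E \<longleftrightarrow> prolong2 \<phi> (x, y, p, q) \<in> E')"
    using assms by (auto simp: maps_equation_def)
  then have "maps_equation \<phi> j E E'" if "j \<in> N" for j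
    using that unfolding maps_equation_def by blast
  with N show thesis
    by (intro that[of N]) auto
qed

lemma maps_equation_compose:
  assumes \<psi>: "open V" "holomorphic_map_on \<psi> V" and \<phi>: "open U" "holomorphic_map_on \<phi> U" and sub: "\<phi> ` U \<subseteq> V"
    and z: "source z \<in> U" and E: "maps_equation \<phi> z E E'" and E': "maps_equation \<psi> (prolong1 \<phi> z) E' E''"
  shows "maps_equation (\<lambda>w. \<psi> (\<phi> w)) z E E''"
proof -
  obtain N where N: "open N" "z \<in> N" "\<And>j. j \<in> N \<Longrightarrow> total_deriv1 (\<lambda>w. fst (\<phi> w)) j \<noteq> 0"
    "\<And>x y p q. (x, y, p) \<in> N \<Longrightarrow> (x, y, p, q) \<in> E \<longleftrightarrow> prolong2 \<phi> (x, y, p, q) \<in> E'"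
    using maps_equationE[OF E] by metis
  obtain N' where N': "open N'" "prolong1 \<phi> z \<in> N'" "\<And>j. j \<in> N' \<Longrightarrow> total_deriv1 (\<lambda>w. fst (\<psi> w)) j \<noteq> 0"
    "\<And>x y p q. (x, y, p) \<in> N' \<Longrightarrow> (x, y, p, q) \<in> E' \<longleftrightarrow> prolong2 \<psi> (x, y, p, q) \<in> E''"
    using maps_equationE[OF E'] by metis
  \<comment> \<open>The 1-jets to which both given maps apply: \<open>N\<close> for \<phi>, and
    \<open>N'\<close> for \<psi> after prolongation. Openness comes from the continuity of
    \<open>prolong1 \<phi>\<close> on regular jets.\<close>
  define M where "M = (N \<inter> source -` U) \<inter> prolong1 \<phi> -` N'"
  have reg: "N \<inter> source -` U \<subseteq> regular_jets U \<phi>"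
    using N(3) by (auto simp: regular_jets_def)
  have "open M"
    unfolding M_def
    by (intro continuous_open_preimage continuous_on_subset[OF continuous_on_prolong1[OF \<phi>] reg]
        open_Int N(1) N'(1) open_source_vimage \<phi>(1))
  moreover have "z \<in> M"
    using N(2) N'(2) z by (simp add: M_def)
  moreover have "total_deriv1 (\<lambda>w. fst (\<psi> (\<phi> w))) (x, y, p) \<noteq> 0 \<and>
      ((x, y, p, q) \<in> E \<longleftrightarrow> prolong2 (\<lambda>w. \<psi> (\<phi> w)) (x, y, p, q) \<in> E'')" if "(x, y, p) \<in> M" for x y p q
  proof -
    have j: "(x, y, p) \<in> regular_jets U \<phi>" and j': "prolong1 \<phi> (x, y, p) \<in> regular_jets V \<psi>"
      using that reg N'(3) sub by (auto simp: M_def regular_jets_def)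
    have "(x, y, p, q) \<in> E \<longleftrightarrow> prolong2 \<phi> (x, y, p, q) \<in> E'"
      using that N(4) by (simp add: M_def)
    also have "\<dots> \<longleftrightarrow> prolong2 \<psi> (prolong2 \<phi> (x, y, p, q)) \<in> E''"
    proof -
      obtain x' y' p' where "prolong1 \<phi> (x, y, p) = (x', y', p')"
        by (metis prod_cases3)
      then show ?thesis
        using that N'(4) by (simp add: M_def prolong2_eq[of \<phi>])
    qed
    finally show ?thesis
      using j j' prolong2_compose[OF \<psi> \<phi> sub j j'] prolong1_compose(1)[OF \<psi>(2) \<phi>(2) sub j]
      by (simp add: regular_jets_def)
  qed
  ultimately show ?thesis
    unfolding maps_equation_def by (intro exI[of _ M]) auto
qed

text \<open>On \<open>U\<close> the composite is the identity, whose prolongations are known; the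
  chain rules give the rest. Regularity holds because the product of the two total derivatives
  equals 1.\<close>

lemma prolong_inverse:
  assumes \<phi>: "local_transformation U \<phi>" and \<psi>: "local_transformation (\<phi> ` U) \<psi>"
    and inv: "\<And>w. w \<in> U \<Longrightarrow> \<psi> (\<phi> w) = w" and j: "(x, y, p) \<in> regular_jets U \<phi>"
  shows "prolong1 \<psi> (prolong1 \<phi> (x, y, p)) = (x, y, p)"
    and "prolong1 \<phi> (x, y, p) \<in> regular_jets (\<phi> ` U) \<psi>"
    and "prolong2 \<psi> (prolong2 \<phi> (x, y, p, q)) = (x, y, p, q)"
proof -
  have U: "open U" "holomorphic_map_on \<phi> U" and V: "open (\<phi> ` U)" "holomorphic_map_on \<psi> (\<phi> ` U)"
    using \<phi> \<psi> by (auto simp: local_transformation_def)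
  have w: "source (x, y, p) \<in> U"
    using j by (simp add: regular_jets_def)
  note cong = prolong_cong[of U "\<lambda>w. \<psi> (\<phi> w)" "\<lambda>w. w" x y p, OF U(1) inv w, unfolded prolong_ident]
  note comp = prolong1_compose[OF V(2) U(2) order_refl j]
  show "prolong1 \<psi> (prolong1 \<phi> (x, y, p)) = (x, y, p)"
    using cong comp by simp
  show j': "prolong1 \<phi> (x, y, p) \<in> regular_jets (\<phi> ` U) \<psi>"
    using cong(1) comp(1) w by (auto simp: regular_jets_def)
  show "prolong2 \<psi> (prolong2 \<phi> (x, y, p, q)) = (x, y, p, q)"
    using cong(3) prolong2_compose[OF V U order_refl j j'] by simp
qed

lemma maps_equation_regular: "maps_equation \<phi> z E E' \<Longrightarrow> source z \<in> U \<Longrightarrow> z \<in> regular_jets U \<phi>"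
  by (auto simp: regular_jets_def elim: maps_equationE)

lemma maps_equation_inverse:
  assumes \<phi>: "local_transformation U \<phi>" and \<psi>: "local_transformation (\<phi> ` U) \<psi>"
    and inv: "\<And>w. w \<in> U \<Longrightarrow> \<psi> (\<phi> w) = w" and z: "source z \<in> U" and E: "maps_equation \<phi> z E E'"
  shows "prolong1 \<psi> (prolong1 \<phi> z) = z" and "maps_equation \<psi> (prolong1 \<phi> z) E' E"
proof -
  have V: "open (\<phi> ` U)" "holomorphic_map_on \<psi> (\<phi> ` U)"
    using \<phi> \<psi> by (auto simp: local_transformation_def)
  have img: "\<psi> ` \<phi> ` U = U"
    using inv by force
  obtain N where N: "open N" "z \<in> N" "\<And>j. j \<in> N \<Longrightarrow> total_deriv1 (\<lambda>w. fst (\<phi> w)) j \<noteq> 0"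
    "\<And>x y p q. (x, y, p) \<in> N \<Longrightarrow> (x, y, p, q) \<in> E \<longleftrightarrow> prolong2 \<phi> (x, y, p, q) \<in> E'"
    using maps_equationE[OF E] by metis
  have z_reg: "z \<in> regular_jets U \<phi>"
    by (rule maps_equation_regular[OF E z])
  show z': "prolong1 \<psi> (prolong1 \<phi> z) = z"
    using prolong_inverse(1)[OF \<phi> \<psi> inv] z_reg by (cases z) auto
  \<comment> \<open>The 1-jets that \<psi> carries into \<open>N\<close>, where \<phi> is known to
    respect the equations.\<close>
  define M where "M = regular_jets (\<phi> ` U) \<psi> \<inter> prolong1 \<psi> -` N"
  have "open M"
    unfolding M_def
    by (intro continuous_open_preimage continuous_on_prolong1 open_regular_jets V N(1))
  moreover have "prolong1 \<phi> z \<in> M"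
    using prolong_inverse(2)[OF \<phi> \<psi> inv] z_reg z' N(2) by (cases z) (auto simp: M_def)
  moreover have "total_deriv1 (\<lambda>w. fst (\<psi> w)) (x, y, p) \<noteq> 0 \<and>
      ((x, y, p, q) \<in> E' \<longleftrightarrow> prolong2 \<psi> (x, y, p, q) \<in> E)" if "(x, y, p) \<in> M" for x y p q
  proof -
    have j: "(x, y, p) \<in> regular_jets (\<phi> ` U) \<psi>" and jN: "prolong1 \<psi> (x, y, p) \<in> N"
      using that by (auto simp: M_def)
    \<comment> \<open>\<phi> also inverts \<psi>, so \<open>prolong_inverse\<close> is used with the
      roles exchanged; \<open>img\<close> identifies the image of the inverse with
      \<open>U\<close>.\<close>
    have "prolong2 \<phi> (prolong2 \<psi> (x, y, p, q)) = (x, y, p, q)"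
      by (rule prolong_inverse(3)[of "\<phi> ` U" \<psi> \<phi>, unfolded img, OF \<psi> \<phi> _ j]) (use inv in auto)
    moreover have "prolong2 \<psi> (x, y, p, q) \<in> E \<longleftrightarrow> prolong2 \<phi> (prolong2 \<psi> (x, y, p, q)) \<in> E'"
    proof -
      obtain x' y' p' where "prolong1 \<psi> (x, y, p) = (x', y', p')"
        by (metis prod_cases3)
      then show ?thesis
        using jN N(4) by (simp add: prolong2_eq[of \<psi>])
    qed
    ultimately show ?thesis
      using j by (simp add: regular_jets_def)
  qed
  ultimately show "maps_equation \<psi> (prolong1 \<phi> z) E' E"
    unfolding maps_equation_def by (intro exI[of _ M]) auto
qed

section \<open>Equivalences and their inverses\<close>

text \<open>Covers both the symmetries, where \<open>E = E'\<close>, and the transformation in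
  \<open>strongly_equivalent\<close>, so that conjugation becomes composition and inversion of one
  kind of object.\<close>

definition equivalence_at :: "groupoid \<Rightarrow> point set \<Rightarrow> (point \<Rightarrow> point) \<Rightarrow> jet1 \<Rightarrow> jet2 set \<Rightarrow> jet2 set \<Rightarrow> bool" where
  "equivalence_at \<Phi> U \<phi> z E E' \<longleftrightarrow>
     local_transformation U \<phi> \<and> has_form \<Phi> U \<phi> \<and> source z \<in> U \<and> maps_equation \<phi> z E E'"

lemma equivalence_at_iff_pseudogroup:
  "equivalence_at \<Phi> U \<phi> z E E' \<longleftrightarrow> (U, \<phi>) \<in> pseudogroup \<Phi> \<and> source z \<in> U \<and> maps_equation \<phi> z E E'"
  by (auto simp: equivalence_at_def pseudogroup_def)

lemma mem_symmetries_iff: "(U, \<sigma>) \<in> symmetries E \<Phi> z \<longleftrightarrow> equivalence_at \<Phi> U \<sigma> z E E"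
  by (auto simp: symmetries_def equivalence_at_iff_pseudogroup)

lemma equivalence_at_holomorphic:
  "equivalence_at \<Phi> U \<phi> z E E' \<Longrightarrow> open U" "equivalence_at \<Phi> U \<phi> z E E' \<Longrightarrow> holomorphic_map_on \<phi> U"
  by (simp_all add: equivalence_at_def local_transformation_def)

lemma equivalence_at_subset:
  "equivalence_at \<Phi> U \<phi> z E E' \<Longrightarrow> open V \<Longrightarrow> V \<subseteq> U \<Longrightarrow> source z \<in> V \<Longrightarrow> equivalence_at \<Phi> V \<phi> z E E'"
  by (auto simp: equivalence_at_def intro: local_transformation_subset has_form_subset)

lemma equivalence_at_compose:
  assumes \<phi>: "equivalence_at \<Phi> U \<phi> z E E'" and \<psi>: "equivalence_at \<Phi> V \<psi> (prolong1 \<phi> z) E' E''" and sub: "\<phi> ` U \<subseteq> V"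
  shows "equivalence_at \<Phi> U (\<lambda>w. \<psi> (\<phi> w)) z E E''"
proof -
  have "maps_equation (\<lambda>w. \<psi> (\<phi> w)) z E E''"
    by (rule maps_equation_compose[OF equivalence_at_holomorphic[OF \<psi>] equivalence_at_holomorphic[OF \<phi>] sub])
      (use \<phi> \<psi> in \<open>auto simp: equivalence_at_def\<close>)
  then show ?thesis
    using \<phi> \<psi> local_transformation_compose[OF _ _ sub] has_form_compose[OF _ _ sub]
    unfolding equivalence_at_def by blast
qed

text \<open>\<open>V\<close> may be smaller than the image of \<open>U\<close>, since
  \<open>has_form_inverse\<close> provides the form of the inverse only near the target
  point.\<close>

lemma equivalence_at_obtain_inverse:
  assumes "equivalence_at \<Phi> U \<phi> z E E'"
  obtains V \<psi> where "equivalence_at \<Phi> V \<psi> (prolong1 \<phi> z) E' E" and "prolong1 \<psi> (prolong1 \<phi> z) = z"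
    and "V \<subseteq> \<phi> ` U" and "\<And>w. w \<in> U \<Longrightarrow> \<psi> (\<phi> w) = w"
proof -
  have \<phi>: "local_transformation U \<phi>" and form: "has_form \<Phi> U \<phi>" and z: "source z \<in> U" and E: "maps_equation \<phi> z E E'"
    using assms by (auto simp: equivalence_at_def)
  obtain \<psi> where \<psi>: "local_transformation (\<phi> ` U) \<psi>" and inv: "\<And>w. w \<in> U \<Longrightarrow> \<psi> (\<phi> w) = w"
    using local_transformation_obtain_inverse[OF \<phi>] by blast
  have "holomorphic_map_on \<psi> (\<phi> ` U)"
    using \<psi> by (simp add: local_transformation_def)
  then obtain V where V: "open V" "\<phi> (source z) \<in> V" "V \<subseteq> \<phi> ` U" "has_form \<Phi> V \<psi>"
    using has_form_inverse[OF \<phi> form _ inv z] by blast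
  have "equivalence_at \<Phi> V \<psi> (prolong1 \<phi> z) E' E"
    using V local_transformation_subset[OF \<psi> V(1,3)] maps_equation_inverse(2)[OF \<phi> \<psi> inv z E]
    by (simp add: equivalence_at_def)
  with V(3) inv maps_equation_inverse(1)[OF \<phi> \<psi> inv z E] show thesis
    by (intro that)
qed

section \<open>Conjugation of symmetry families\<close>

text \<open>The 1-jet is built from values and first partial derivatives at a fixed point, with a
  nonzero denominator. The partial derivatives depend continuously on the parameter by
  \<open>continuous_on_partial1_param\<close> and
  \<open>continuous_on_partial2_param\<close>.\<close>

lemma continuous_on_prolong1_param:
  fixes \<sigma> :: "'a::topological_space \<Rightarrow> point \<Rightarrow> point"
  assumes V: "open V" "source z \<in> V" and cont: "continuous_on (W \<times> V) (\<lambda>(c, w). \<sigma> c w)"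
    and hol: "\<And>c. c \<in> W \<Longrightarrow> holomorphic_map_on (\<sigma> c) V"
    and nz: "\<And>c. c \<in> W \<Longrightarrow> total_deriv1 (\<lambda>w. fst (\<sigma> c w)) z \<noteq> 0"
  shows "continuous_on W (\<lambda>c. prolong1 (\<sigma> c) z)"
proof -
  have at_z: "continuous_on W (\<lambda>c. F c (source z))" if "continuous_on (W \<times> V) (\<lambda>(c, w). F c w)"
    for F :: "'a \<Rightarrow> point \<Rightarrow> 'b::topological_space"
  proof -
    have "continuous_on W (\<lambda>c. (c, source z))"
      by (intro continuous_on_Pair continuous_on_id continuous_on_const)
    from continuous_on_compose2[OF that this] show ?thesis
      using V(2) by auto
  qed
  have total: "continuous_on W (\<lambda>c. total_deriv1 (\<lambda>w. f (\<sigma> c w)) z)"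
    if f: "continuous_on UNIV f" and hol_f: "\<And>c. c \<in> W \<Longrightarrow> holomorphic2_on (\<lambda>w. f (\<sigma> c w)) V" for f
  proof -
    have c: "continuous_on (W \<times> V) (\<lambda>(c, w). f (\<sigma> c w))"
      using continuous_on_compose2[OF f cont] by (simp add: split_beta)
    have "(\<lambda>t. f (\<sigma> c (t, y))) field_differentiable at x \<and> (\<lambda>t. f (\<sigma> c (x, t))) field_differentiable at y"
      if "c \<in> W" "(x, y) \<in> V" for c x y
      using holomorphic2_imp_sep[OF hol_f] that by (auto simp: sep_holomorphic_on_def)
    then have "continuous_on (W \<times> V) (\<lambda>(c, w). partial1 (\<lambda>w. f (\<sigma> c w)) w)"
      and "continuous_on (W \<times> V) (\<lambda>(c, w). partial2 (\<lambda>w. f (\<sigma> c w)) w)"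
      by (auto intro!: continuous_on_partial1_param[OF V(1) c] continuous_on_partial2_param[OF V(1) c])
    from this[THEN at_z] show ?thesis
      unfolding total_deriv1_eq by (intro continuous_intros)
  qed
  have "continuous_on W (\<lambda>c. prolonged_slope (\<sigma> c) z)"
    unfolding prolonged_slope_def
    using hol nz by (intro continuous_on_divide total) (auto simp: holomorphic_map_on_def intro!: continuous_intros)
  with at_z[OF cont] show ?thesis
    unfolding prolong1_eq by (intro continuous_on_Pair continuous_on_fst continuous_on_snd)
qed

text \<open>Keeps a family holomorphic in each parameter when a fixed holomorphic function is
  applied to its values.\<close>

lemma field_differentiable_compose_holomorphic2:
  assumes g: "holomorphic2_on g U" and "(f1 t, f2 t) \<in> U"
    and "f1 field_differentiable at t" and "f2 field_differentiable at t"
  shows "(\<lambda>s. g (f1 s, f2 s)) field_differentiable at t"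
proof -
  let ?a = "partial1 g (f1 t, f2 t)" and ?b = "partial2 g (f1 t, f2 t)"
  obtain d1 d2 where "(f1 has_derivative (*) d1) (at t)" "(f2 has_derivative (*) d2) (at t)"
    using assms(3,4) by (auto simp: field_differentiable_def has_field_derivative_def)
  from has_derivative_compose[OF has_derivative_Pair[OF this] holomorphic2_has_derivative[OF g assms(2)]]
  have "((\<lambda>s. g (f1 s, f2 s)) has_field_derivative (?a * d1 + ?b * d2)) (at t)"
    unfolding has_field_derivative_def by (rule has_derivative_eq_rhs) (auto simp: algebra_simps)
  then show ?thesis
    by (auto simp: field_differentiable_def)
qed

text \<open>The new family is
  \<open>\<phi> \<circ> \<rho> \<circ> \<sigma> c \<circ> \<theta>\<close>, where \<rho> and
  \<theta> are local inverses of \<open>\<sigma> c0\<close> and \<phi>. For \<open>c = c0\<close> it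
  is the identity near the base point, so for \<open>c\<close> close to \<open>c0\<close> the
  compositions are defined on one common domain.\<close>

lemma has_arbitrary_constants_transfer:
  assumes \<phi>: "equivalence_at \<Phi> U \<phi> z E E'" and "has_arbitrary_constants E \<Phi> z d"
  shows "has_arbitrary_constants E' \<Phi> (prolong1 \<phi> z) d"
proof -
  obtain W V \<sigma> where W: "W \<noteq> {}" "openin (top_of_set (param_space d)) W"
    and sym_ball: "\<forall>c\<in>W. equivalence_at \<Phi> V (\<sigma> c) z E E"
    and cont: "continuous_on (W \<times> V) (\<lambda>(c, w). \<sigma> c w)"
    and diff: "\<forall>c\<in>W. \<forall>w\<in>V. \<forall>i<d.
      (\<lambda>t. fst (\<sigma> (c(i := t)) w)) field_differentiable (at (c i)) \<and>
      (\<lambda>t. snd (\<sigma> (c(i := t)) w)) field_differentiable (at (c i))"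
    and inj: "inj_on (\<lambda>c. taylor (\<sigma> c) (source z)) W"
    using assms(2) unfolding has_arbitrary_constants_def mem_symmetries_iff
    by (elim exE conjE) (rule that; assumption)
  have sym: "equivalence_at \<Phi> V (\<sigma> c) z E E" if "c \<in> W" for c
    using sym_ball that by (rule bspec)
  obtain c0 where c0: "c0 \<in> W"
    using W(1) by blast
  have V: "open V" "source z \<in> V"
    using sym[OF c0] by (auto simp: equivalence_at_def local_transformation_def)
  have U: "open U" "source z \<in> U"
    using \<phi> by (auto simp: equivalence_at_def local_transformation_def)
  define z' where "z' = prolong1 \<phi> z"
  \<comment> \<open>The 1-jet to which \<open>\<sigma> c0\<close> carries \<open>z\<close>. Its base
    point may lie outside the domain of \<phi>, so \<rho> has to lead back to \<open>z\<close>
    first.\<close>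
  define z1 where "z1 = prolong1 (\<sigma> c0) z"
  obtain R \<rho> where \<rho>: "equivalence_at \<Phi> R \<rho> z1 E E" "prolong1 \<rho> z1 = z"
    using equivalence_at_obtain_inverse[OF sym[OF c0]] unfolding z1_def by metis
  obtain X \<theta> where \<theta>: "equivalence_at \<Phi> X \<theta> z' E' E" "prolong1 \<theta> z' = z" "\<And>w. w \<in> U \<Longrightarrow> \<theta> (\<phi> w) = w"
    using equivalence_at_obtain_inverse[OF \<phi>] unfolding z'_def by metis
  have R: "open R" "source z1 \<in> R" and X: "open X" "source z' \<in> X"
    using \<rho>(1) \<theta>(1) by (auto simp: equivalence_at_def local_transformation_def)
  have \<rho>z: "\<rho> (source z1) = source z" and \<theta>z: "\<theta> (source z') = source z"
    using \<rho>(2) \<theta>(2) source_prolong1 by metis+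
  have cont_\<rho>: "continuous_on R \<rho>" and cont_\<theta>: "continuous_on X \<theta>"
    using \<rho>(1) \<theta>(1) by (auto intro: holomorphic_map_continuous equivalence_at_holomorphic)

  \<comment> \<open>\<open>R'\<close> is where \<rho> lands in the domain of \<phi>; \<kappa> is the
    part of the conjugation that follows \<open>\<sigma> c\<close>, and it is the same for all
    \<open>c\<close>.\<close>
  define R' where "R' = R \<inter> \<rho> -` U"
  define \<kappa> where "\<kappa> = (\<lambda>w. \<phi> (\<rho> w))"
  have R': "open R'" "source z1 \<in> R'"
    unfolding R'_def using R U \<rho>z by (auto intro!: continuous_open_preimage cont_\<rho>)
  have \<kappa>: "equivalence_at \<Phi> R' \<kappa> z1 E E'"
    unfolding \<kappa>_def
    by (rule equivalence_at_compose[OF equivalence_at_subset[OF \<rho>(1) R'(1) _ R'(2)]])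
      (use \<phi> \<rho>(2) in \<open>auto simp: R'_def\<close>)
  \<comment> \<open>\<open>\<sigma> c\<close> carries \<open>z\<close> to a 1-jet close to
    \<open>z1\<close> but in general different from it, so \<kappa> has to be controlled at all
    1-jets of a neighbourhood.\<close>
  obtain N where N: "open N" "z1 \<in> N" "\<And>j. j \<in> N \<Longrightarrow> maps_equation \<kappa> j E E'"
    using \<kappa> unfolding equivalence_at_def by (metis maps_equationE)

  \<comment> \<open>Joint continuity yields a box \<open>A \<times> B\<close> around
    \<open>(c0, source z)\<close> in which \<open>\<sigma> c w\<close> stays in \<open>R'\<close>.
    Thus \<open>B\<close> cuts out a domain valid for all nearby \<open>c\<close> at once.\<close>
  have "openin (top_of_set (W \<times> V)) ((W \<times> V) \<inter> (\<lambda>(c, w). \<sigma> c w) -` R')"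
    using cont R'(1) continuous_openin_preimage_gen by blast
  then obtain T where T: "open T" "(W \<times> V) \<inter> (\<lambda>(c, w). \<sigma> c w) -` R' = (W \<times> V) \<inter> T"
    by (auto simp: openin_open)
  moreover have "\<sigma> c0 (source z) \<in> R'"
    using R'(2) by (simp add: z1_def)
  ultimately have "(c0, source z) \<in> T"
    using c0 V(2) by auto
  then obtain A B where AB: "open A" "open B" "c0 \<in> A" "source z \<in> B" "A \<times> B \<subseteq> T"
    using open_prod_elim[OF T(1), of "(c0, source z)"] by (metis mem_Sigma_iff)
  have near: "\<sigma> c w \<in> R'" if "c \<in> W" "c \<in> A" "w \<in> V" "w \<in> B" for c w
  proof -
    have "(c, w) \<in> (W \<times> V) \<inter> T"
      using that AB(5) by auto
    then show ?thesis
      unfolding T(2)[symmetric] by simp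
  qed

  \<comment> \<open>Continuity of the 1-jet in \<open>c\<close> keeps
    \<open>prolong1 (\<sigma> c) z\<close> inside \<open>N\<close> for \<open>c\<close> near
    \<open>c0\<close>.\<close>
  have "continuous_on W (\<lambda>c. prolong1 (\<sigma> c) z)"
    using sym by (intro continuous_on_prolong1_param[OF V cont])
      (auto simp: equivalence_at_def local_transformation_def elim: maps_equationE)
  then have "openin (top_of_set W) (W \<inter> (\<lambda>c. prolong1 (\<sigma> c) z) -` N \<inter> A)"
    by (intro openin_Int_open continuous_openin_preimage_gen N(1) AB(1))
  define W' where "W' = W \<inter> (\<lambda>c. prolong1 (\<sigma> c) z) -` N \<inter> A"
  \<comment> \<open>Openness in \<open>W\<close> becomes openness in the parameter space, since
    \<open>W\<close> is open there.\<close>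
  have W': "openin (top_of_set (param_space d)) W'" "c0 \<in> W'" "W' \<subseteq> W"
    unfolding W'_def
    using openin_trans[OF \<open>openin (top_of_set W) _\<close> W(2)] c0 N(2) AB(3) by (auto simp: z1_def)

  define V' where "V' = X \<inter> \<theta> -` (V \<inter> B)"
  define \<tau> where "\<tau> = (\<lambda>c w. \<kappa> (\<sigma> c (\<theta> w)))"
  have V': "open V'" "source z' \<in> V'"
    unfolding V'_def using X V AB \<theta>z
    by (intro continuous_open_preimage cont_\<theta> open_Int, simp_all)
  have in_R': "\<sigma> c (\<theta> w) \<in> R'" if "c \<in> W'" "w \<in> V'" for c w
    using that near by (auto simp: W'_def V'_def)
  have \<tau>_sym: "equivalence_at \<Phi> V' (\<tau> c) z' E' E'" if c: "c \<in> W'" for c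
  proof -
    have cW: "c \<in> W" "prolong1 (\<sigma> c) z \<in> N" "c \<in> A"
      using c by (auto simp: W'_def)
    have \<sigma>c: "equivalence_at \<Phi> (V \<inter> B) (\<sigma> c) z E E"
      using V AB by (intro equivalence_at_subset[OF sym[OF cW(1)]]) auto
    \<comment> \<open>The base jet of \<kappa> moves from \<open>z1\<close> to the 1-jet reached by
      \<open>\<sigma> c\<close>.\<close>
    have "equivalence_at \<Phi> R' \<kappa> (prolong1 (\<sigma> c) z) E E'"
      using \<kappa> N(3)[OF cW(2)] near[OF cW(1,3) V(2) AB(4)] by (simp add: equivalence_at_def)
    then have "equivalence_at \<Phi> (V \<inter> B) (\<lambda>w. \<kappa> (\<sigma> c w)) z E E'"
      by (rule equivalence_at_compose[OF \<sigma>c]) (use near cW in auto)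
    then have "equivalence_at \<Phi> (V \<inter> B) (\<lambda>w. \<kappa> (\<sigma> c w)) (prolong1 \<theta> z') E E'"
      by (simp add: \<theta>(2))
    moreover have "equivalence_at \<Phi> V' \<theta> z' E' E"
      by (rule equivalence_at_subset[OF \<theta>(1) V'(1) _ V'(2)]) (auto simp: V'_def)
    ultimately show ?thesis
      unfolding \<tau>_def using equivalence_at_compose[of \<Phi> V' \<theta> z' E' E "V \<inter> B" "\<lambda>w. \<kappa> (\<sigma> c w)" E']
      by (auto simp: V'_def)
  qed
  have \<kappa>_hol: "holomorphic_map_on \<kappa> R'" "inj_on \<kappa> R'"
    using \<kappa> equivalence_at_holomorphic(2) local_transformation_inj
    unfolding equivalence_at_def by blast+

  have "continuous_on (W' \<times> V') (\<lambda>(c, w). \<tau> c w)"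
  proof -
    have "continuous_on (W' \<times> V') (\<lambda>q. \<theta> (snd q))"
      by (rule continuous_on_compose2[OF cont_\<theta>]) (auto simp: V'_def intro!: continuous_intros)
    then have pair: "continuous_on (W' \<times> V') (\<lambda>q. (fst q, \<theta> (snd q)))"
      by (intro continuous_intros)
    have "(\<lambda>q. (fst q, \<theta> (snd q))) ` (W' \<times> V') \<subseteq> W \<times> V"
      using W'(3) by (auto simp: V'_def)
    from continuous_on_compose2[OF cont pair this]
    have "continuous_on (W' \<times> V') (\<lambda>q. \<sigma> (fst q) (\<theta> (snd q)))"
      by simp
    then have "continuous_on (W' \<times> V') (\<lambda>q. \<kappa> (\<sigma> (fst q) (\<theta> (snd q))))"
      by (rule continuous_on_compose2[OF holomorphic_map_continuous[OF \<kappa>_hol(1)]]) (use in_R' in auto)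
    then show ?thesis
      by (simp add: \<tau>_def split_beta)
  qed
  moreover have "(\<lambda>t. fst (\<tau> (c(i := t)) w)) field_differentiable (at (c i)) \<and>
      (\<lambda>t. snd (\<tau> (c(i := t)) w)) field_differentiable (at (c i))" if "c \<in> W'" "w \<in> V'" "i < d" for c w i
  proof -
    have "\<theta> w \<in> V" "c \<in> W"
      using that W'(3) by (auto simp: V'_def)
    note d = diff[rule_format, OF this(2,1) \<open>i < d\<close>]
    \<comment> \<open>The composition rule evaluates the inner function at \<open>t = c i\<close>
      only, where \<open>c(i := t)\<close> is \<open>c\<close> itself, so its value lies in
      \<open>R'\<close>.\<close>
    have "(\<lambda>t. g (fst (\<sigma> (c(i := t)) (\<theta> w)), snd (\<sigma> (c(i := t)) (\<theta> w)))) field_differentiable (at (c i))"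
      if "holomorphic2_on g R'" for g
      by (rule field_differentiable_compose_holomorphic2[OF that])
        (use d in_R' \<open>c \<in> W'\<close> \<open>w \<in> V'\<close> in auto)
    from this[of "\<lambda>w. fst (\<kappa> w)"] this[of "\<lambda>w. snd (\<kappa> w)"] show ?thesis
      using \<kappa>_hol(1) by (simp add: \<tau>_def holomorphic_map_on_def)
  qed
  \<comment> \<open>Equal Taylor series give equal germs. Then \<kappa> is cancelled by its
    injectivity and \<theta> by inserting the points \<open>\<phi> w\<close>, so
    \<open>\<sigma> c\<close> and \<open>\<sigma> c'\<close> have the same germ at
    \<open>source z\<close> and injectivity of the given family applies.\<close>
  moreover have "inj_on (\<lambda>c. taylor (\<tau> c) (source z')) W'"
  proof
    fix c c' assume c: "c \<in> W'" "c' \<in> W'" and eq: "taylor (\<tau> c) (source z') = taylor (\<tau> c') (source z')"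
    have "\<forall>\<^sub>F w in nhds (source z'). \<tau> c w = \<tau> c' w"
      by (rule taylor_eq_imp_eq_near[OF V' equivalence_at_holomorphic(2) equivalence_at_holomorphic(2) eq])
        (use \<tau>_sym c in auto)
    moreover have "\<forall>\<^sub>F w in nhds (source z'). w \<in> V'"
      using V' by (rule eventually_nhds_in_open)
    ultimately have "\<forall>\<^sub>F w in nhds (source z'). \<sigma> c (\<theta> w) = \<sigma> c' (\<theta> w)"
      by eventually_elim (use \<kappa>_hol(2) in_R' c in \<open>auto simp: \<tau>_def dest: inj_onD\<close>)
    moreover have "filterlim \<phi> (nhds (source z')) (nhds (source z))"
    proof -
      have "isCont \<phi> (source z)"
        using holomorphic_map_continuous[OF equivalence_at_holomorphic(2)[OF \<phi>]] U
        by (simp add: continuous_on_eq_continuous_at)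
      then show ?thesis
        by (simp add: z'_def isCont_def tendsto_nhds_iff)
    qed
    ultimately have "\<forall>\<^sub>F w in nhds (source z). \<sigma> c (\<theta> (\<phi> w)) = \<sigma> c' (\<theta> (\<phi> w))"
      by (rule eventually_compose_filterlim)
    moreover have "\<forall>\<^sub>F w in nhds (source z). w \<in> U"
      using U by (rule eventually_nhds_in_open)
    ultimately have "\<forall>\<^sub>F w in nhds (source z). \<sigma> c w = \<sigma> c' w"
      by eventually_elim (simp add: \<theta>(3))
    from taylor_cong[OF this] show "c = c'"
      using inj c W'(3) by (auto dest: inj_onD)
  qed
  ultimately show ?thesis
    unfolding has_arbitrary_constants_def mem_symmetries_iff z'_def[symmetric]
    using W' \<tau>_sym by (intro exI[of _ W'] exI[of _ V'] exI[of _ \<tau>]) auto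
qed

text \<open>Families are transferred in one direction along \<phi> and in the other along its local
  inverse, which returns to the same 1-jet \<open>z\<close>.\<close>

lemma sym_dim_invariant:
  assumes "equivalence_at \<Phi> U \<phi> z E E'"
  shows "sym_dim E \<Phi> z = sym_dim E' \<Phi> (prolong1 \<phi> z)"
proof -
  obtain V \<psi> where "equivalence_at \<Phi> V \<psi> (prolong1 \<phi> z) E' E" "prolong1 \<psi> (prolong1 \<phi> z) = z"
    using equivalence_at_obtain_inverse[OF assms] by metis
  then have "has_arbitrary_constants E \<Phi> z d \<longleftrightarrow> has_arbitrary_constants E' \<Phi> (prolong1 \<phi> z) d" for d
    using has_arbitrary_constants_transfer assms by metis
  then show ?thesis
    by (simp add: sym_dim_def)
qed

section \<open>Inclusions among the pseudo-groups and comparison of dimensions\<close>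

definition subgroupoid :: "groupoid \<Rightarrow> groupoid \<Rightarrow> bool" where
  "subgroupoid \<Phi> \<Psi> \<longleftrightarrow> (\<forall>U \<phi>. has_form \<Phi> U \<phi> \<longrightarrow> has_form \<Psi> U \<phi>)"

text \<open>The constant \<open>C = 0\<close> puts the first form of each chain into the second, and
  a shift is a function of one coordinate, which puts the second into the third.\<close>

lemma subgroupoid_chains:
  "subgroupoid Phi1 Phi3" "subgroupoid Phi3 Phi5" "subgroupoid Phi2 Phi4" "subgroupoid Phi4 Phi6" "subgroupoid \<Phi> Phi7" "subgroupoid \<Phi> \<Phi>"
  by (force simp: subgroupoid_def intro: exI[of _ 0])+

lemma subgroupoid_trans: "subgroupoid \<Phi> \<Psi> \<Longrightarrow> subgroupoid \<Psi> X \<Longrightarrow> subgroupoid \<Phi> X"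
  by (auto simp: subgroupoid_def)

text \<open>A family of symmetries in the smaller pseudo-group is also one in the larger, with the
  same parameters.\<close>

lemma sym_dim_mono:
  assumes "subgroupoid \<Phi> \<Psi>"
  shows "sym_dim E \<Phi> z \<le> sym_dim E \<Psi> z"
proof -
  have "symmetries E \<Phi> z \<subseteq> symmetries E \<Psi> z"
    using assms by (auto simp: symmetries_def pseudogroup_def subgroupoid_def)
  then have "has_arbitrary_constants E \<Phi> z d \<Longrightarrow> has_arbitrary_constants E \<Psi> z d" for d
    unfolding has_arbitrary_constants_def
    by (elim ex_forward conj_forward) (assumption | blast)+
  then show ?thesis
    unfolding sym_dim_def by (intro Sup_subset_mono) auto
qed

lemma sym_dim_eq_of_comparable:
  assumes \<phi>: "equivalence_at \<Phi> U \<phi> z E E'" and zero: "sym_dim E' \<Phi> (prolong1 \<phi> z) = 0"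
    and "subgroupoid \<Phi> \<Psi> \<or> subgroupoid \<Psi> \<Phi>"
  shows "sym_dim E \<Psi> z = sym_dim E' \<Psi> (prolong1 \<phi> z)"
  using assms(3)
proof
  assume "subgroupoid \<Phi> \<Psi>"
  with \<phi> have "equivalence_at \<Psi> U \<phi> z E E'"
    by (auto simp: equivalence_at_def subgroupoid_def)
  then show ?thesis
    by (rule sym_dim_invariant)
next
  assume le: "subgroupoid \<Psi> \<Phi>"
  \<comment> \<open>Invariance carries the zero from \<open>E'\<close> back to \<open>E\<close>, and
    monotonicity then forces both dimensions for \<Psi> to be zero.\<close>
  have "sym_dim E \<Phi> z = 0"
    using sym_dim_invariant[OF \<phi>] zero by simp
  with zero sym_dim_mono[OF le, of E z] sym_dim_mono[OF le, of E' "prolong1 \<phi> z"] show ?thesis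
    by simp
qed

theorem lemma2:
  fixes D D' :: "jet1 set" and f f' :: "jet1 \<Rightarrow> complex" and z z' :: jet1
  assumes "second_order_ode D f" and "second_order_ode D' f'"
    and "z \<in> D" and "z' \<in> D'"
    and "strongly_equivalent (equation D f) z (equation D' f') z'"
  shows "signatures_match (signature_index (equation D f) z) (signature_index (equation D' f') z')"
proof -
  obtain \<Phi> U \<phi> where "equivalence_at \<Phi> U \<phi> z (equation D f) (equation D' f')" "prolong1 \<phi> z = z'"
    and "sym_dim (equation D' f') \<Phi> z' = 0"
    using assms(5) unfolding strongly_equivalent_def equivalence_at_iff_pseudogroup by blast
  then have eq: "sym_dim (equation D f) \<Psi> z = sym_dim (equation D' f') \<Psi> z'"
    if "subgroupoid \<Phi> \<Psi> \<or> subgroupoid \<Psi> \<Phi>" for \<Psi>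
    using sym_dim_eq_of_comparable that by blast
  \<comment> \<open>Odd indices belong to the first chain and even ones to the second;
    \<open>Phi7\<close> lies above both.\<close>
  have "(\<forall>\<Psi>\<in>{Phi1, Phi3, Phi5}. subgroupoid \<Phi> \<Psi> \<or> subgroupoid \<Psi> \<Phi>) \<or>
      (\<forall>\<Psi>\<in>{Phi2, Phi4, Phi6}. subgroupoid \<Phi> \<Psi> \<or> subgroupoid \<Psi> \<Phi>)"
    by (cases \<Phi>) (simp_all add: subgroupoid_chains subgroupoid_trans[OF subgroupoid_chains(1,2)]
        subgroupoid_trans[OF subgroupoid_chains(3,4)])
  \<comment> \<open>\<open>Phi7\<close> is comparable with every \<Phi>, so the last entries of the
    signatures agree in each case.\<close>
  with eq subgroupoid_chains(5) show ?thesis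
    by (auto simp: signatures_match_def signature_index_def)
qed

end
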